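(* Let $\mathbb{F}$ be a field of positive characteristic $\ell$, and let $n=p^m$ be a prime power ($p$ prime, $m\ge 1$). Assume $\ell\neq 2,3$ and $\ell\neq p$. If either (1) $p=2$ and $-1$ is a square in $\mathbb{F}$, or (2) $p>2$ and $\mathbb{F}$ contains a primitive $p$th root of unity, then $\mathfrak{sl}_n(\mathbb{F})$ has a classical orthogonal decomposition (COD).
   Context: $\mathfrak{sl}_n(\mathbb{F})$ denotes the Lie algebra of $n\times n$ traceless matrices over $\mathbb{F}$ with bracket $[A,B]=AB-BA$. A Cartan subalgebra of a Lie algebra $\mathfrak{L}$ is a nilpotent subalgebra equal to its own normalizer. A classical Cartan subalgebra of $\mathfrak{L}=\mathfrak{sl}_n(\mathbb{F})$ (with $\ell=\mathrm{char}\,\mathbb{F}$) is an abelian Cartan subalgebra $H$ such that: (a) $\mathfrak{L}=\bigoplus_\alpha \mathfrak{L}_\alpha$, where $\alpha$ ranges over linear functionals on $H$ and $\mathfrak{L}_\alpha=\{x: [x,h]=\alpha(h)x \ \forall h\in H\}$ (the nonzero such $\alpha$ with $\mathfrak{L}_\alpha\ne0$, together with $0$, are the roots); (b) if $\alpha\neq 0$ is a root then $[\mathfrak{L}_\alpha,\mathfrak{L}_{-\alpha}]$ is one-dimensional; (c) if $\alpha,\beta$ are roots with $\beta\neq0$, then not all of $\alpha+k\beta$, $1\le k\le \ell-1$, are roots. The Killing form on $\mathfrak{sl}_n(\mathbb{F})$ is $K(A,B)=\mathrm{Tr}(\mathrm{ad}A\,\mathrm{ad}B)=2n\,\mathrm{Tr}(AB)$.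 A classical orthogonal decomposition (COD) of $\mathfrak{sl}_n(\mathbb{F})$ is a vector space direct sum decomposition $\mathfrak{sl}_n(\mathbb{F})=H_0\oplus H_1\oplus\cdots\oplus H_n$ in which every $H_i$ is a classical Cartan subalgebra and $K(H_i,H_j)=0$ for all $i\neq j$. *)

theory Defs
  imports Main "HOL-Library.Function_Algebras" "HOL-Computational_Algebra.Primes"
begin

text \<open>n x n matrices over a field 'a are represented as functions nat => nat => 'a
  whose entries vanish outside the index range {0..<n} x {0..<n}.  Addition, zero and
  negation are the pointwise operations (HOL-Library.Function_Algebras).\<close>

type_synonym 'a sqmat = "nat \<Rightarrow> nat \<Rightarrow> 'a"

definition is_mat :: "nat \<Rightarrow> 'a::zero sqmat \<Rightarrow> bool" where
  "is_mat n A \<longleftrightarrow> (\<forall>i j. (n \<le> i \<or> n \<le> j) \<longrightarrow> A i j = 0)"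

definition mat_mult :: "nat \<Rightarrow> 'a::comm_ring_1 sqmat \<Rightarrow> 'a sqmat \<Rightarrow> 'a sqmat" where
  "mat_mult n A B = (\<lambda>i j. \<Sum>k<n. A i k * B k j)"

definition smat :: "'a::comm_ring_1 \<Rightarrow> 'a sqmat \<Rightarrow> 'a sqmat" where
  "smat c A = (\<lambda>i j. c * A i j)"

definition mtrace :: "nat \<Rightarrow> 'a::comm_ring_1 sqmat \<Rightarrow> 'a" where
  "mtrace n A = (\<Sum>i<n. A i i)"

definition sl :: "nat \<Rightarrow> 'a::field sqmat set" where
  "sl n = {A. is_mat n A \<and> mtrace n A = 0}"

definition bracket :: "nat \<Rightarrow> 'a::comm_ring_1 sqmat \<Rightarrow> 'a sqmat \<Rightarrow> 'a sqmat" where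
  "bracket n A B = mat_mult n A B - mat_mult n B A"

text \<open>Killing form of sl_n(F): K(A,B) = Tr(ad A ad B) = 2n Tr(AB).\<close>

definition killing :: "nat \<Rightarrow> 'a::field sqmat \<Rightarrow> 'a sqmat \<Rightarrow> 'a" where
  "killing n A B = 2 * of_nat n * mtrace n (mat_mult n A B)"

definition lspan :: "'a::field sqmat set \<Rightarrow> 'a sqmat set" where
  "lspan S = {x. \<exists>F c. finite F \<and> F \<subseteq> S \<and> x = (\<Sum>v\<in>F. smat (c v) v)}"

definition is_subspace :: "'a::field sqmat set \<Rightarrow> bool" where
  "is_subspace V \<longleftrightarrow> 0 \<in> V \<and> (\<forall>x\<in>V. \<forall>y\<in>V. x + y \<in> V) \<and> (\<forall>c. \<forall>x\<in>V. smat c x \<in> V)"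

definition one_dimensional :: "'a::field sqmat set \<Rightarrow> bool" where
  "one_dimensional V \<longleftrightarrow> (\<exists>z. z \<noteq> 0 \<and> V = {smat c z | c. True})"

definition direct_sum :: "'i set \<Rightarrow> ('i \<Rightarrow> 'a::field sqmat set) \<Rightarrow> 'a sqmat set \<Rightarrow> bool" where
  "direct_sum I V L \<longleftrightarrow>
     (\<forall>i\<in>I. V i \<subseteq> L) \<and>
     (\<forall>x\<in>L. \<exists>F v. finite F \<and> F \<subseteq> I \<and> (\<forall>i\<in>F. v i \<in> V i) \<and> x = (\<Sum>i\<in>F. v i)) \<and>
     (\<forall>F v. finite F \<and> F \<subseteq> I \<and> (\<forall>i\<in>F. v i \<in> V i) \<and> (\<Sum>i\<in>F. v i) = 0
              \<longrightarrow> (\<forall>i\<in>F. v i = 0))"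

definition subalgebra :: "nat \<Rightarrow> 'a::field sqmat set \<Rightarrow> bool" where
  "subalgebra n H \<longleftrightarrow> H \<subseteq> sl n \<and> is_subspace H \<and> (\<forall>x\<in>H. \<forall>y\<in>H. bracket n x y \<in> H)"

text \<open>Nilpotent: the lower central series H^1 = H, H^(k+1) = [H, H^k] reaches 0, i.e.
  (since H^(k+1) is spanned by the left-normed brackets [x1,[x2,...,[xk,y]]]) for some k
  all k-fold brackets of elements of H vanish.\<close>

definition nilpotent_alg :: "nat \<Rightarrow> 'a::field sqmat set \<Rightarrow> bool" where
  "nilpotent_alg n H \<longleftrightarrow>
     (\<exists>k. \<forall>xs y. length xs = k \<and> set xs \<subseteq> H \<and> y \<in> H \<longrightarrow> foldr (bracket n) xs y = 0)"

definition normalizer :: "nat \<Rightarrow> 'a::field sqmat set \<Rightarrow> 'a sqmat set" where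
  "normalizer n H = {x \<in> sl n. \<forall>h\<in>H. bracket n x h \<in> H}"

definition cartan :: "nat \<Rightarrow> 'a::field sqmat set \<Rightarrow> bool" where
  "cartan n H \<longleftrightarrow> subalgebra n H \<and> nilpotent_alg n H \<and> normalizer n H = H"

definition abelian :: "nat \<Rightarrow> 'a::field sqmat set \<Rightarrow> bool" where
  "abelian n H \<longleftrightarrow> (\<forall>x\<in>H. \<forall>y\<in>H. bracket n x y = 0)"

text \<open>Linear functionals on H, normalised to be 0 outside H so that distinct functionals
  on H are distinct HOL functions.\<close>

definition lin_fun :: "'a::field sqmat set \<Rightarrow> ('a sqmat \<Rightarrow> 'a) \<Rightarrow> bool" where
  "lin_fun H \<alpha> \<longleftrightarrow> (\<forall>x\<in>H. \<forall>y\<in>H. \<alpha> (x + y) = \<alpha> x + \<alpha> y) \<and>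
                   (\<forall>c. \<forall>x\<in>H. \<alpha> (smat c x) = c * \<alpha> x) \<and>
                   (\<forall>x. x \<notin> H \<longrightarrow> \<alpha> x = 0)"

definition root_space :: "nat \<Rightarrow> 'a::field sqmat set \<Rightarrow> ('a sqmat \<Rightarrow> 'a) \<Rightarrow> 'a sqmat set" where
  "root_space n H \<alpha> = {x \<in> sl n. \<forall>h\<in>H. bracket n x h = smat (\<alpha> h) x}"

definition is_root :: "nat \<Rightarrow> 'a::field sqmat set \<Rightarrow> ('a sqmat \<Rightarrow> 'a) \<Rightarrow> bool" where
  "is_root n H \<alpha> \<longleftrightarrow> lin_fun H \<alpha> \<and> (\<alpha> = (\<lambda>_. 0) \<or> root_space n H \<alpha> \<noteq> {0})"

definition classical_cartan :: "nat \<Rightarrow> 'a::field sqmat set \<Rightarrow> bool" where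
  "classical_cartan n H \<longleftrightarrow>
     cartan n H \<and> abelian n H \<and>
     direct_sum {\<alpha>. lin_fun H \<alpha>} (root_space n H) (sl n) \<and>
     (\<forall>\<alpha>. is_root n H \<alpha> \<and> \<alpha> \<noteq> (\<lambda>_. 0) \<longrightarrow>
        one_dimensional (lspan {bracket n x y | x y.
            x \<in> root_space n H \<alpha> \<and> y \<in> root_space n H (\<lambda>h. - \<alpha> h)})) \<and>
     (\<forall>\<alpha> \<beta>. is_root n H \<alpha> \<and> is_root n H \<beta> \<and> \<beta> \<noteq> (\<lambda>_. 0) \<longrightarrow>
        \<not> (\<forall>k::nat. 1 \<le> k \<and> k \<le> CHAR('a) - 1 \<longrightarrow>
              is_root n H (\<lambda>h. \<alpha> h + of_nat k * \<beta> h)))"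

definition is_COD :: "nat \<Rightarrow> (nat \<Rightarrow> 'a::field sqmat set) \<Rightarrow> bool" where
  "is_COD n H \<longleftrightarrow>
     direct_sum {..n} H (sl n) \<and>
     (\<forall>i\<le>n. classical_cartan n (H i)) \<and>
     (\<forall>i\<le>n. \<forall>j\<le>n. i \<noteq> j \<longrightarrow> (\<forall>x\<in>H i. \<forall>y\<in>H j. killing n x y = 0))"

definition primitive_root_of_unity :: "nat \<Rightarrow> 'a::field \<Rightarrow> bool" where
  "primitive_root_of_unity k z \<longleftrightarrow> z ^ k = 1 \<and> (\<forall>j. 0 < j \<and> j < k \<longrightarrow> z ^ j \<noteq> 1)"

end

theory Submission
  imports Defs Complex_Main "HOL-Computational_Algebra.Polynomial" "HOL-Computational_Algebra.Primes"
begin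

text \<open>
  The Cartan subalgebras are the traceless diagonal algebras of \<open>n + 1\<close> mutually unbiased bases. For a field \<open>K\<close>
  with \<open>n = p\<^sup>m\<close> elements and a nontrivial additive character \<open>\<chi> : K \<rightarrow> \<F>\<^sup>\<times>\<close>, index matrices by \<open>K\<close> and take
  the standard basis together with, for each \<open>a \<in> K\<close>, the vectors \<open>x \<mapsto> \<phi>\<^sub>a(x) \<chi>(t x)\<close>, \<open>t \<in> K\<close>, where
  \<open>\<phi>\<^sub>a(x + y) = \<phi>\<^sub>a(x) \<phi>\<^sub>a(y) \<chi>(a x y)\<close>. For odd \<open>p\<close> one can take \<open>\<phi>\<^sub>a(x) = \<chi>(a x\<^sup>2 / 2)\<close>; for \<open>p = 2\<close> the values of
  \<open>\<phi>\<^sub>a\<close> are fourth roots of unity, which is where a square root of -1 is needed.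

  The rank one projections \<open>E\<close> of all these bases satisfy \<open>\<Sum> E \<otimes> E = id + swap\<close>. Contracting this identity with a
  traceless matrix decomposes it into the diagonal algebras, and unbiasedness makes them orthogonal, hence independent.
\<close>

section \<open>Algebras of matrices diagonal in a given basis\<close>

text \<open>Three obstacles shape the proof. The ground field has no conjugation, so every basis is
  carried together with its dual basis, and unbiasedness is a statement about traces of products of
  projections. The field with n elements is obtained without an irreducible polynomial of degree m:
  it is a residue field of Z[zeta], zeta a complex root of unity of order n - 1, at a maximal ideal
  over p. The powers of zeta give n - 1 distinct nonzero residues and Frobenius shows that there are
  no others; what remains is that p is not a unit in Z[zeta], a question of bounded denominators.
  Finally, the identity between projections rests on the fact that an unordered pair of field
  elements is determined by its sum and its product: the summation within a basis fixes the sum, the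
  summation over the parameter a fixes the product. Characteristic different from p makes n
  invertible; characteristic different from 2 and 3 separates 2 from 0, 1 and -1, the only values of
  a root at a projection.\<close>

definition coord :: "nat \<Rightarrow> 'a::field sqmat \<Rightarrow> 'a sqmat \<Rightarrow> 'a sqmat \<Rightarrow> 'a sqmat" where
  "coord n P Q A = (\<lambda>s t. \<Sum>x<n. \<Sum>y<n. Q s x * A x y * P t y)"

text \<open>Row \<open>P t\<close> is the t-th basis vector and row \<open>Q s\<close> the s-th dual
  functional, so this inverts \<open>coord\<close>. The cut-off outside the index range is what
  \<open>is_mat\<close> demands.\<close>

definition uncoord :: "nat \<Rightarrow> 'a::field sqmat \<Rightarrow> 'a sqmat \<Rightarrow> 'a sqmat \<Rightarrow> 'a sqmat" where
  "uncoord n P Q C = (\<lambda>x y. if x < n \<and> y < n then \<Sum>s<n. \<Sum>t<n. P s x * C s t * Q t y else 0)"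

definition diag_sub :: "nat \<Rightarrow> 'a::field sqmat \<Rightarrow> 'a sqmat \<Rightarrow> 'a sqmat set" where
  "diag_sub n P Q = {A \<in> sl n. \<forall>s<n. \<forall>t<n. s \<noteq> t \<longrightarrow> coord n P Q A s t = 0}"

lemma sum_fun_apply2: "(\<Sum>i\<in>F. f i) x y = (\<Sum>i\<in>F. f i x y)"
  for f :: "'i \<Rightarrow> 'b \<Rightarrow> 'c \<Rightarrow> 'a::comm_monoid_add"
  by (induction F rule: infinite_finite_induct) auto

lemma sum_sandwich:
  fixes A :: "'a::field sqmat"
  shows "(\<Sum>s<n. \<Sum>t<n. p s * (\<Sum>u<n. \<Sum>v<n. q s u * A u v * r t v) * w t)
       = (\<Sum>u<n. \<Sum>v<n. (\<Sum>s<n. p s * q s u) * A u v * (\<Sum>t<n. r t v * w t))"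
proof -
  have "(\<Sum>s<n. \<Sum>t<n. p s * (\<Sum>u<n. \<Sum>v<n. q s u * A u v * r t v) * w t)
      = (\<Sum>(s,t)\<in>{..<n}\<times>{..<n}. \<Sum>(u,v)\<in>{..<n}\<times>{..<n}. p s * q s u * A u v * (r t v * w t))"
    by (simp add: sum.cartesian_product [symmetric] sum_distrib_left sum_distrib_right mult.assoc)
  also have "\<dots> = (\<Sum>(u,v)\<in>{..<n}\<times>{..<n}. \<Sum>(s,t)\<in>{..<n}\<times>{..<n}. p s * q s u * A u v * (r t v * w t))"
    unfolding case_prod_unfold by (rule sum.swap)
  also have "\<dots> = (\<Sum>u<n. \<Sum>v<n. (\<Sum>s<n. p s * q s u) * A u v * (\<Sum>t<n. r t v * w t))"
    by (simp add: sum.cartesian_product [symmetric] sum_distrib_left sum_distrib_right mult.assoc)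
       (intro sum.cong refl sum.swap)
  finally show ?thesis .
qed

lemma sum_of_bool_lessThan:
  "(\<Sum>i<n. of_bool (i = k) * f i) = (if k < n then f k else 0)"
  "(\<Sum>i<n. of_bool (k = i) * f i) = (if k < n then f k else 0)"
  "(\<Sum>i<n. f i * of_bool (i = k)) = (if k < n then f k else 0)"
  "(\<Sum>i<n. f i * of_bool (k = i)) = (if k < n then f k else 0)"
  for f :: "nat \<Rightarrow> 'a::field"
  by (simp_all add: of_bool_def if_distrib [of "\<lambda>x. x * _"] if_distrib [of "\<lambda>x. _ * x"] sum.delta sum.delta' cong: if_cong)

lemma coord_add: "coord n P Q (A + B) s t = coord n P Q A s t + coord n P Q B s t"
  by (simp add: coord_def algebra_simps sum.distrib)

lemma coord_diff: "coord n P Q (A - B) s t = coord n P Q A s t - coord n P Q B s t"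
  by (simp add: coord_def algebra_simps sum_subtractf)

lemma coord_smat: "coord n P Q (smat c A) s t = c * coord n P Q A s t"
  by (simp add: coord_def smat_def sum_distrib_left mult_ac)

lemma coord_zero: "coord n P Q 0 s t = 0"
  by (simp add: coord_def)

lemma coord_sum: "coord n P Q (\<Sum>i\<in>F. f i) s t = (\<Sum>i\<in>F. coord n P Q (f i) s t)"
  by (induction F rule: infinite_finite_induct)
    (simp_all add: coord_zero coord_add del: plus_fun_apply zero_fun_apply plus_fun_def zero_fun_def)

lemma is_mat_mult: "is_mat n A \<Longrightarrow> is_mat n B \<Longrightarrow> is_mat n (mat_mult n A B)"
  by (auto simp: is_mat_def mat_mult_def)

lemma is_mat_bracket: "is_mat n A \<Longrightarrow> is_mat n B \<Longrightarrow> is_mat n (bracket n A B)"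
  using is_mat_mult[of n A B] is_mat_mult[of n B A] by (simp add: bracket_def is_mat_def)

lemma sl_subspace: "is_subspace (sl n)"
  by (auto simp: is_subspace_def sl_def is_mat_def mtrace_def smat_def sum.distrib simp flip: sum_distrib_left)

lemma direct_sumI:
  assumes "\<And>i. i \<in> I \<Longrightarrow> V i \<subseteq> L"
    and "\<And>x. x \<in> L \<Longrightarrow> \<exists>F v. finite F \<and> F \<subseteq> I \<and> (\<forall>i\<in>F. v i \<in> V i) \<and> x = sum v F"
    and "\<And>F v i. finite F \<Longrightarrow> F \<subseteq> I \<Longrightarrow> (\<And>j. j \<in> F \<Longrightarrow> v j \<in> V j) \<Longrightarrow> sum v F = 0 \<Longrightarrow> i \<in> F \<Longrightarrow> v i = 0"
  shows "direct_sum I V L"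
  unfolding direct_sum_def
proof (intro conjI)
  show "\<forall>i\<in>I. V i \<subseteq> L" using assms(1) by simp
  show "\<forall>x\<in>L. \<exists>F v. finite F \<and> F \<subseteq> I \<and> (\<forall>i\<in>F. v i \<in> V i) \<and> x = sum v F"
    using assms(2) by simp
  show "\<forall>F v. finite F \<and> F \<subseteq> I \<and> (\<forall>i\<in>F. v i \<in> V i) \<and> sum v F = 0 \<longrightarrow> (\<forall>i\<in>F. v i = 0)"
  proof (intro allI impI ballI, elim conjE)
    fix F v i
    assume "finite F" "F \<subseteq> I" "\<forall>i\<in>F. v i \<in> V i" "sum v F = 0" "i \<in> F"
    then show "v i = 0" by (intro assms(3)[of F v i]) auto
  qed
qed

text \<open>Both orders of the inverse relation are assumed, so a one-sided inverse never has to be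
  shown two-sided; in the application each order is its own character sum.\<close>

locale dual_bases =
  fixes n :: nat and P Q :: "'a::field sqmat"
  assumes QP: "s < n \<Longrightarrow> t < n \<Longrightarrow> (\<Sum>x<n. Q s x * P t x) = of_bool (s = t)"
    and PQ: "x < n \<Longrightarrow> y < n \<Longrightarrow> (\<Sum>t<n. P t x * Q t y) = of_bool (x = y)"
begin

abbreviation "hat \<equiv> coord n P Q"
abbreviation "unhat \<equiv> uncoord n P Q"
abbreviation "H \<equiv> diag_sub n P Q"

lemma is_mat_unhat: "is_mat n (unhat C)"
  by (simp add: is_mat_def uncoord_def)

lemma unhat_hat:
  assumes "is_mat n A"
  shows "unhat (hat A) = A"
proof (intro ext)
  fix x y
  show "unhat (hat A) x y = A x y"
  proof (cases "x < n \<and> y < n")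
    case True
    then have "unhat (hat A) x y = (\<Sum>u<n. \<Sum>v<n. (\<Sum>s<n. P s x * Q s u) * A u v * (\<Sum>t<n. P t v * Q t y))"
      by (simp add: uncoord_def coord_def sum_sandwich)
    also have "\<dots> = (\<Sum>u<n. \<Sum>v<n. of_bool (x = u) * (A u v * of_bool (v = y)))"
      using True by (intro sum.cong refl) (simp add: PQ)
    also have "\<dots> = A x y"
      using True by (simp flip: sum_distrib_left add: sum_of_bool_lessThan)
    finally show ?thesis .
  next
    case False
    then show ?thesis using assms by (auto simp: uncoord_def is_mat_def)
  qed
qed

lemma hat_unhat:
  assumes "s < n" "t < n"
  shows "hat (unhat C) s t = C s t"
proof -
  have "hat (unhat C) s t = (\<Sum>x<n. \<Sum>y<n. Q s x * (\<Sum>u<n. \<Sum>v<n. P u x * C u v * Q v y) * P t y)"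
    by (simp add: coord_def uncoord_def)
  also have "\<dots> = (\<Sum>u<n. \<Sum>v<n. (\<Sum>x<n. Q s x * P u x) * C u v * (\<Sum>y<n. Q v y * P t y))"
    by (rule sum_sandwich)
  also have "\<dots> = (\<Sum>u<n. \<Sum>v<n. of_bool (s = u) * (C u v * of_bool (v = t)))"
    using assms by (intro sum.cong refl) (simp add: QP)
  also have "\<dots> = C s t"
    using assms by (simp flip: sum_distrib_left add: sum_of_bool_lessThan)
  finally show ?thesis .
qed

lemma hat_eqI:
  assumes "is_mat n A" "is_mat n B" "\<And>s t. s < n \<Longrightarrow> t < n \<Longrightarrow> hat A s t = hat B s t"
  shows "A = B"
proof -
  have "unhat (hat A) = unhat (hat B)"
    using assms(3) by (auto simp: uncoord_def fun_eq_iff intro!: sum.cong)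
  then show ?thesis
    using assms by (simp add: unhat_hat)
qed

text \<open>Inserts the resolution of the identity \<open>PQ\<close> between two vectors; this makes
  \<open>hat\<close> multiplicative.\<close>

lemma sum_contract:
  "(\<Sum>k<n. (\<Sum>u<n. L u * P k u) * (\<Sum>v<n. Q k v * R v)) = (\<Sum>u<n. L u * R u)"
proof -
  have "(\<Sum>k<n. (\<Sum>u<n. L u * P k u) * (\<Sum>v<n. Q k v * R v))
      = (\<Sum>k<n. \<Sum>u<n. \<Sum>v<n. L u * R v * (P k u * Q k v))"
    by (simp add: sum_product mult_ac)
  also have "\<dots> = (\<Sum>u<n. \<Sum>k<n. \<Sum>v<n. L u * R v * (P k u * Q k v))"
    by (rule sum.swap)
  also have "\<dots> = (\<Sum>u<n. \<Sum>v<n. \<Sum>k<n. L u * R v * (P k u * Q k v))"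
    by (intro sum.cong refl sum.swap)
  also have "\<dots> = (\<Sum>u<n. \<Sum>v<n. L u * R v * of_bool (u = v))"
    by (intro sum.cong refl) (simp flip: sum_distrib_left add: PQ)
  also have "\<dots> = (\<Sum>u<n. L u * R u)"
    by (simp add: sum_of_bool_lessThan)
  finally show ?thesis .
qed

lemma hat_mult: "hat (mat_mult n A B) s t = (\<Sum>k<n. hat A s k * hat B k t)"
proof -
  have L: "hat A s k = (\<Sum>u<n. (\<Sum>x<n. Q s x * A x u) * P k u)" for k
    unfolding coord_def by (subst sum.swap) (simp add: sum_distrib_right)
  have R: "hat B k t = (\<Sum>v<n. Q k v * (\<Sum>y<n. B v y * P t y))" for k
    unfolding coord_def by (simp add: sum_distrib_left mult.assoc)
  have "(\<Sum>k<n. hat A s k * hat B k t) = (\<Sum>u<n. (\<Sum>x<n. Q s x * A x u) * (\<Sum>y<n. B u y * P t y))"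
    unfolding L R by (rule sum_contract)
  also have "\<dots> = (\<Sum>u<n. \<Sum>x<n. \<Sum>y<n. Q s x * (A x u * B u y) * P t y)"
    by (simp add: sum_product mult_ac)
  also have "\<dots> = (\<Sum>x<n. \<Sum>u<n. \<Sum>y<n. Q s x * (A x u * B u y) * P t y)"
    by (rule sum.swap)
  also have "\<dots> = (\<Sum>x<n. \<Sum>y<n. \<Sum>u<n. Q s x * (A x u * B u y) * P t y)"
    by (intro sum.cong refl sum.swap)
  also have "\<dots> = hat (mat_mult n A B) s t"
    by (simp add: coord_def mat_mult_def sum_distrib_left sum_distrib_right)
  finally show ?thesis ..
qed

lemma mtrace_hat: "mtrace n A = (\<Sum>s<n. hat A s s)"
proof -
  have "(\<Sum>s<n. hat A s s) = (\<Sum>s<n. \<Sum>(x,y)\<in>{..<n}\<times>{..<n}. A x y * (P s y * Q s x))"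
    unfolding coord_def sum.cartesian_product by (intro sum.cong refl) (auto simp: mult_ac)
  also have "\<dots> = (\<Sum>(x,y)\<in>{..<n}\<times>{..<n}. \<Sum>s<n. A x y * (P s y * Q s x))"
    unfolding case_prod_unfold by (rule sum.swap)
  also have "\<dots> = (\<Sum>(x,y)\<in>{..<n}\<times>{..<n}. A x y * of_bool (y = x))"
    by (intro sum.cong refl) (auto simp flip: sum_distrib_left simp: PQ)
  also have "\<dots> = mtrace n A"
    by (simp add: sum.cartesian_product [symmetric] mtrace_def sum_of_bool_lessThan)
  finally show ?thesis ..
qed

lemma mtrace_unhat: "mtrace n (unhat C) = (\<Sum>s<n. C s s)"
  by (simp add: mtrace_hat hat_unhat)

lemma H_iff: "A \<in> H \<longleftrightarrow> is_mat n A \<and> mtrace n A = 0 \<and> (\<forall>s<n. \<forall>t<n. s \<noteq> t \<longrightarrow> hat A s t = 0)"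
  by (auto simp: diag_sub_def sl_def)

lemma H_sl: "A \<in> H \<Longrightarrow> A \<in> sl n"
  by (simp add: diag_sub_def)

text \<open>A diagonal h acts entry by entry. With the convention [x,h] = \<alpha>(h) x the position
  (s,t) has weight h_t - h_s, opposite to the customary sign.\<close>

lemma hat_bracket_H:
  assumes "h \<in> H" "s < n" "t < n"
  shows "hat (bracket n A h) s t = hat A s t * (hat h t t - hat h s s)"
proof -
  have d: "hat h k l = of_bool (k = l) * hat h k k" if "k < n" "l < n" for k l
    using assms(1) that by (auto simp: H_iff)
  have "hat (bracket n A h) s t = (\<Sum>k<n. hat A s k * hat h k t) - (\<Sum>k<n. hat h s k * hat A k t)"
    by (simp add: bracket_def coord_diff hat_mult)
  also have "(\<Sum>k<n. hat A s k * hat h k t) = (\<Sum>k<n. of_bool (k = t) * (hat h k k * hat A s k))"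
    using assms by (intro sum.cong refl, subst d) (auto simp: mult_ac)
  also have "\<dots> = hat h t t * hat A s t"
    using assms by (simp add: sum_of_bool_lessThan)
  also have "(\<Sum>k<n. hat h s k * hat A k t) = (\<Sum>k<n. of_bool (s = k) * (hat h s s * hat A k t))"
    using assms by (intro sum.cong refl, subst d) (auto simp: mult_ac)
  also have "\<dots> = hat h s s * hat A s t"
    using assms by (simp add: sum_of_bool_lessThan)
  finally show ?thesis by (simp add: algebra_simps)
qed

lemma H_abelian:
  assumes "x \<in> H" "y \<in> H"
  shows "bracket n x y = 0"
proof (rule hat_eqI)
  show "is_mat n (bracket n x y)"
    using assms by (intro is_mat_bracket) (auto simp: H_iff)
  show "is_mat n (0 :: 'a sqmat)"
    by (simp add: is_mat_def)
  show "hat (bracket n x y) s t = hat 0 s t" if "s < n" "t < n" for s t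
    using assms that by (cases "s = t") (auto simp: hat_bracket_H coord_zero H_iff)
qed

lemma H_subspace: "is_subspace H"
  using sl_subspace[of n] by (auto simp: is_subspace_def diag_sub_def coord_add coord_smat coord_zero)

lemma bracket_root_iff:
  assumes "x \<in> sl n" "h \<in> H"
  shows "bracket n x h = smat c x \<longleftrightarrow> (\<forall>s<n. \<forall>t<n. hat x s t * (hat h t t - hat h s s) = c * hat x s t)"
    (is "?L \<longleftrightarrow> ?R")
proof
  assume ?L
  then show ?R
    using hat_bracket_H[OF assms(2), of _ _ x] by (metis coord_smat)
next
  assume ?R
  show ?L
  proof (rule hat_eqI)
    show "is_mat n (bracket n x h)"
      using assms by (intro is_mat_bracket) (auto simp: H_iff sl_def)
    show "is_mat n (smat c x)"
      using assms by (auto simp: sl_def is_mat_def smat_def)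
    show "hat (bracket n x h) s t = hat (smat c x) s t" if "s < n" "t < n" for s t
      using \<open>?R\<close> that by (simp add: hat_bracket_H[OF assms(2)] coord_smat)
  qed
qed

text \<open>The value 0 off \<open>H\<close> is the normalisation of \<open>lin_fun\<close>; it
  makes equality of weights equality of functions.\<close>

definition wt :: "nat \<Rightarrow> nat \<Rightarrow> 'a sqmat \<Rightarrow> 'a" where
  "wt s t h = (if h \<in> H then hat h t t - hat h s s else 0)"

lemma wt_lin_fun: "lin_fun H (wt s t)"
  using H_subspace by (auto simp: lin_fun_def wt_def is_subspace_def coord_add coord_smat algebra_simps)

lemma root_space_iff:
  "x \<in> root_space n H \<alpha> \<longleftrightarrow>
     x \<in> sl n \<and> (\<forall>h\<in>H. \<forall>s<n. \<forall>t<n. hat x s t * wt s t h = \<alpha> h * hat x s t)"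
  by (auto simp: root_space_def bracket_root_iff wt_def simp del: mult_cancel_left mult_cancel_right) (metis mult.commute)+

text \<open>A nonzero entry can be cancelled in \<open>root_space_iff\<close>, so any position in
  the support dictates the functional.\<close>

lemma root_space_weight:
  assumes x: "x \<in> root_space n H \<alpha>" and \<alpha>: "lin_fun H \<alpha>" and "s < n" "t < n" "hat x s t \<noteq> 0"
  shows "\<alpha> = wt s t"
proof
  fix h
  show "\<alpha> h = wt s t h"
  proof (cases "h \<in> H")
    case True
    then have "hat x s t * wt s t h = \<alpha> h * hat x s t"
      using x assms(3,4) unfolding root_space_iff by blast
    then show ?thesis using assms(5) by simp
  next
    case False
    then show ?thesis using \<alpha> by (simp add: lin_fun_def wt_def)
  qed
qed

lemma unhat_root_space:
  assumes "\<And>s t. s < n \<Longrightarrow> t < n \<Longrightarrow> C s t \<noteq> 0 \<Longrightarrow> \<alpha> = wt s t" "(\<Sum>s<n. C s s) = 0"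
  shows "unhat C \<in> root_space n H \<alpha>"
  unfolding root_space_iff
proof (intro conjI ballI allI impI)
  show "unhat C \<in> sl n" using assms(2) by (simp add: sl_def is_mat_unhat mtrace_unhat)
  show "hat (unhat C) s t * wt s t h = \<alpha> h * hat (unhat C) s t" if "s < n" "t < n" for h s t
    using assms(1)[OF that] that by (cases "C s t = 0") (simp_all add: hat_unhat)
qed

end

section \<open>The root system of a diagonal algebra\<close>

locale classical_dual_bases = dual_bases +
  assumes n_nonzero: "of_nat n \<noteq> (0::'a)"
    and char: "CHAR('a) \<ge> 5"
begin

text \<open>The first inequality separates a root from its negative; the other two keep 2 out of {0,
  1, -1}.\<close>

lemma small_nonzero: "(1::'a) \<noteq> -1" "(2::'a) \<noteq> 0" "(3::'a) \<noteq> 0"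
proof -
  have *: "of_nat k \<noteq> (0::'a)" if "0 < k" "k < 5" for k
    using that char by (auto simp: of_nat_eq_0_iff_char_dvd dest: dvd_imp_le)
  show 2: "(2::'a) \<noteq> 0" using *[of 2] by simp
  show "(3::'a) \<noteq> 0" using *[of 3] by simp
  show "(1::'a) \<noteq> -1"
    using 2 by (metis add.right_inverse one_add_one)
qed

text \<open>A projection onto a basis line, made traceless by subtracting a multiple of the identity,
  which does not change its weights.\<close>

definition proj :: "nat \<Rightarrow> 'a sqmat" where
  "proj r = unhat (\<lambda>s t. of_bool (s = t) * (of_bool (s = r) - 1 / of_nat n))"

lemma hat_proj:
  "s < n \<Longrightarrow> t < n \<Longrightarrow> hat (proj r) s t = of_bool (s = t) * (of_bool (s = r) - 1 / of_nat n)"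
  by (simp only: proj_def hat_unhat)

lemma proj_H:
  assumes "r < n"
  shows "proj r \<in> H"
proof -
  have "mtrace n (proj r) = (\<Sum>s<n. of_bool (s = r) * 1 - 1 / of_nat n)"
    by (simp add: mtrace_hat hat_proj)
  also have "\<dots> = 0"
    using assms n_nonzero by (simp only: sum_subtractf sum_of_bool_lessThan) simp
  finally show ?thesis
    by (simp add: H_iff hat_proj) (simp add: proj_def is_mat_unhat)
qed

lemma wt_proj:
  assumes "r < n" "s < n" "t < n"
  shows "wt s t (proj r) = of_bool (t = r) - of_bool (s = r)"
  using assms proj_H[OF assms(1)] by (simp add: wt_def hat_proj)

lemma wt_zero: "wt s s = (\<lambda>_. 0)"
  by (simp add: wt_def fun_eq_iff)

text \<open>The weight is 1 at \<open>proj t\<close> and -1 at \<open>proj s\<close>; as 1 and -1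
  differ, these values locate both indices.\<close>

lemma wt_inj:
  assumes "s < n" "t < n" "k < n" "l < n" "s \<noteq> t" "wt s t = wt k l"
  shows "k = s \<and> l = t"
proof -
  have "wt s t (proj t) = wt k l (proj t)" "wt s t (proj s) = wt k l (proj s)"
    using assms by simp_all
  then show ?thesis
    using assms(1-5) small_nonzero(1) by (auto simp: wt_proj of_bool_def split: if_splits)
qed

lemma uminus_wt: "(\<lambda>h. - wt s t h) = wt t s"
  by (simp add: wt_def fun_eq_iff)

lemma H_cartan: "cartan n H"
proof -
  have "0 \<in> H" using H_subspace by (simp add: is_subspace_def)
  then have "subalgebra n H"
    using H_subspace H_sl by (auto simp: subalgebra_def H_abelian)
  moreover have "nilpotent_alg n H"
    unfolding nilpotent_alg_def
  proof (intro exI allI impI)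
    fix xs y
    assume *: "length xs = 1 \<and> set xs \<subseteq> H \<and> y \<in> H"
    then obtain x where "xs = [x]" by (auto simp: length_Suc_conv)
    then show "foldr (bracket n) xs y = 0" using * by (simp add: H_abelian)
  qed
  moreover have "normalizer n H = H"
  proof
    show "H \<subseteq> normalizer n H"
      using \<open>0 \<in> H\<close> by (auto simp: normalizer_def H_abelian H_sl)
    show "normalizer n H \<subseteq> H"
    proof
      fix x
      assume x: "x \<in> normalizer n H"
      \<comment> \<open>\<open>wt s t\<close> is 1 at \<open>proj t\<close>, so bracketing with
        \<open>proj t\<close> keeps the entry (s,t), while membership of the bracket in
        \<open>H\<close> makes it vanish.\<close>
      have "hat x s t = 0" if st: "s < n" "t < n" "s \<noteq> t" for s t
      proof -
        have "bracket n x (proj t) \<in> H"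
          using x st by (simp add: normalizer_def proj_H)
        then have "hat (bracket n x (proj t)) s t = 0"
          using st by (simp add: H_iff)
        moreover have "hat (bracket n x (proj t)) s t = hat x s t"
          using hat_bracket_H[OF proj_H st(1,2), of t x] wt_proj[of t s t] st
          by (simp add: wt_def proj_H)
        ultimately show ?thesis by simp
      qed
      then show "x \<in> H" using x by (simp add: normalizer_def diag_sub_def)
    qed
  qed
  ultimately show ?thesis by (simp add: cartan_def)
qed

text \<open>The entries of x are grouped by weight, not by position: all diagonal positions share
  the weight zero, and only together are they traceless.\<close>

lemma sl_eq_sum_root_spaces:
  assumes x: "x \<in> sl n"
  shows "\<exists>F v. finite F \<and> F \<subseteq> {\<alpha>. lin_fun H \<alpha>} \<and> (\<forall>\<alpha>\<in>F. v \<alpha> \<in> root_space n H \<alpha>) \<and> x = sum v F"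
proof -
  define F where "F = (\<lambda>(s, t). wt s t) ` ({..<n} \<times> {..<n})"
  define v where "v \<alpha> = unhat (\<lambda>s t. of_bool (\<alpha> = wt s t) * hat x s t)" for \<alpha>
  have "v \<alpha> \<in> root_space n H \<alpha>" for \<alpha>
  proof -
    have "(\<Sum>s<n. of_bool (\<alpha> = wt s s) * hat x s s) = of_bool (\<alpha> = (\<lambda>_. 0)) * mtrace n x"
      by (simp add: wt_zero mtrace_hat)
    also have "\<dots> = 0" using x by (simp add: sl_def)
    finally show ?thesis unfolding v_def by (intro unhat_root_space) auto
  qed
  moreover have "x = (\<Sum>\<alpha>\<in>F. v \<alpha>)"
  proof (rule hat_eqI)
    show "is_mat n x" using x by (simp add: sl_def)
    show "is_mat n (\<Sum>\<alpha>\<in>F. v \<alpha>)"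
      using is_mat_unhat by (simp add: is_mat_def sum_fun_apply2 v_def)
    fix s t
    assume st: "s < n" "t < n"
    have "wt s t \<in> F" "finite F" using st by (auto simp: F_def)
    moreover have "hat (\<Sum>\<alpha>\<in>F. v \<alpha>) s t = (\<Sum>\<alpha>\<in>F. if \<alpha> = wt s t then hat x s t else 0)"
      using st by (auto simp: coord_sum v_def hat_unhat intro!: sum.cong)
    ultimately show "hat x s t = hat (\<Sum>\<alpha>\<in>F. v \<alpha>) s t" by simp
  qed
  moreover have "finite F" "F \<subseteq> {\<alpha>. lin_fun H \<alpha>}"
    by (auto simp: F_def wt_lin_fun)
  ultimately show "\<exists>F v. finite F \<and> F \<subseteq> {\<alpha>. lin_fun H \<alpha>} \<and> (\<forall>\<alpha>\<in>F. v \<alpha> \<in> root_space n H \<alpha>) \<and> x = sum v F"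
    by (intro exI[of _ F] exI[of _ v]) simp
qed

text \<open>The entry (s,t) can be nonzero only in the summand of weight \<open>wt s t\<close>, so
  no cancellation between summands occurs at any position.\<close>

lemma root_spaces_independent:
  assumes F: "finite F" "F \<subseteq> {\<alpha>. lin_fun H \<alpha>}" and v: "\<And>\<beta>. \<beta> \<in> F \<Longrightarrow> v \<beta> \<in> root_space n H \<beta>"
    and zero: "sum v F = 0" and \<alpha>: "\<alpha> \<in> F"
  shows "v \<alpha> = 0"
proof (rule hat_eqI)
  show "is_mat n (v \<alpha>)" using v[OF \<alpha>] by (simp add: root_space_def sl_def)
  show "is_mat n (0 :: 'a sqmat)" by (simp add: is_mat_def)
  fix s t
  assume st: "s < n" "t < n"
  have "hat (v \<alpha>) s t = 0"
  proof (rule ccontr)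
    assume nz: "hat (v \<alpha>) s t \<noteq> 0"
    have wt: "\<beta> = wt s t" if "\<beta> \<in> F" "hat (v \<beta>) s t \<noteq> 0" for \<beta>
      using root_space_weight[OF v _ st] that F(2) by blast
    have "0 = hat (\<Sum>\<beta>\<in>F. v \<beta>) s t" by (simp only: zero coord_zero)
    also have "\<dots> = (\<Sum>\<beta>\<in>F. if \<beta> = \<alpha> then hat (v \<alpha>) s t else 0)"
      unfolding coord_sum using wt[OF \<alpha> nz] wt by (intro sum.cong refl) auto
    also have "\<dots> = hat (v \<alpha>) s t" using F \<alpha> by simp
    finally show False using nz by simp
  qed
  then show "hat (v \<alpha>) s t = hat 0 s t" by (simp add: coord_zero)
qed

lemma H_root_decomposition: "direct_sum {\<alpha>. lin_fun H \<alpha>} (root_space n H) (sl n)"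
proof (rule direct_sumI)
  show "root_space n H \<alpha> \<subseteq> sl n" for \<alpha>
    by (auto simp: root_space_def)
qed (fact sl_eq_sum_root_spaces root_spaces_independent)+

lemma root_is_wt:
  assumes "is_root n H \<alpha>" "0 < n"
  obtains s t where "s < n" "t < n" "\<alpha> = wt s t"
proof (cases "\<alpha> = (\<lambda>_. 0)")
  case True
  then show ?thesis using assms(2) that[of 0 0] by (simp add: wt_zero)
next
  case False
  have "0 \<in> root_space n H \<alpha>"
    using sl_subspace[of n] by (auto simp: root_space_iff coord_zero is_subspace_def)
  with False obtain x where x: "x \<in> root_space n H \<alpha>" "x \<noteq> 0"
    using assms(1) by (auto simp: is_root_def)
  have "\<exists>s<n. \<exists>t<n. hat x s t \<noteq> 0"
  proof (rule ccontr)
    assume "\<not> ?thesis"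
    then have "x = 0"
      using x(1) by (intro hat_eqI) (auto simp: root_space_def sl_def is_mat_def coord_zero)
    then show False using x(2) by simp
  qed
  then show ?thesis
    using that root_space_weight[OF x(1)] assms(1) by (auto simp: is_root_def)
qed

definition unit :: "nat \<Rightarrow> nat \<Rightarrow> 'a sqmat" where
  "unit s t = unhat (\<lambda>k l. of_bool (k = s \<and> l = t))"

lemma hat_unit: "k < n \<Longrightarrow> l < n \<Longrightarrow> hat (unit s t) k l = of_bool (k = s \<and> l = t)"
  by (simp add: unit_def hat_unhat)

text \<open>By \<open>wt_inj\<close> no other position carries this weight, so nonzero roots have
  multiplicity one.\<close>

lemma root_space_eq:
  assumes "s < n" "t < n" "s \<noteq> t"
  shows "root_space n H (wt s t) = {smat c (unit s t) | c. True}"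
proof (intro equalityI subsetI)
  fix x
  assume x: "x \<in> root_space n H (wt s t)"
  have "x = smat (hat x s t) (unit s t)"
  proof (rule hat_eqI)
    show "is_mat n x" using x by (simp add: root_space_def sl_def)
    show "is_mat n (smat (hat x s t) (unit s t))"
      using is_mat_unhat by (simp add: is_mat_def smat_def unit_def)
    fix k l
    assume kl: "k < n" "l < n"
    show "hat x k l = hat (smat (hat x s t) (unit s t)) k l"
      using root_space_weight[OF x wt_lin_fun kl] wt_inj[OF assms(1,2) kl assms(3)] kl
      by (auto simp: coord_smat hat_unit)
  qed
  then show "x \<in> {smat c (unit s t) | c. True}" by blast
next
  fix x
  assume "x \<in> {smat c (unit s t) | c. True}"
  then obtain c where x: "x = smat c (unit s t)" by blast
  have "unit s t \<in> root_space n H (wt s t)"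
    unfolding unit_def using assms
    by (intro unhat_root_space sum.neutral) (auto split: if_splits simp: of_bool_def)
  then show "x \<in> root_space n H (wt s t)"
    using sl_subspace[of n] by (auto simp: x root_space_iff coord_smat is_subspace_def)
qed

lemma bracket_unit:
  assumes "s < n" "t < n"
  shows "bracket n (smat c (unit s t)) (smat d (unit t s))
       = smat (c * d) (unhat (\<lambda>k l. of_bool (k = s \<and> l = s) - of_bool (k = t \<and> l = t)))"
    (is "_ = smat _ ?z")
proof (rule hat_eqI)
  show "is_mat n (bracket n (smat c (unit s t)) (smat d (unit t s)))"
    using is_mat_unhat by (intro is_mat_bracket) (simp_all add: is_mat_def smat_def unit_def)
  show "is_mat n (smat (c * d) ?z)"
    using is_mat_unhat by (simp add: is_mat_def smat_def)
  fix k l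
  assume kl: "k < n" "l < n"
  have "hat (bracket n (smat c (unit s t)) (smat d (unit t s))) k l
      = (\<Sum>j<n. of_bool (j = t) * (c * d * of_bool (k = s \<and> l = s)))
      - (\<Sum>j<n. of_bool (j = s) * (c * d * of_bool (k = t \<and> l = t)))"
    unfolding bracket_def coord_diff hat_mult
    using kl by (intro arg_cong2[of _ _ _ _ "(-)"] sum.cong refl) (auto simp: coord_smat hat_unit)
  also have "\<dots> = c * d * (of_bool (k = s \<and> l = s) - of_bool (k = t \<and> l = t))"
    by (simp only: sum_of_bool_lessThan assms if_True right_diff_distrib)
  also have "\<dots> = hat (smat (c * d) ?z) k l"
    using kl by (simp add: coord_smat hat_unhat)
  finally show "hat (bracket n (smat c (unit s t)) (smat d (unit t s))) k l = hat (smat (c * d) ?z) k l" .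
qed

lemma lspan_line: "lspan {smat c z | c. True} = {smat c z | c. True}"
proof (intro equalityI subsetI)
  fix x
  assume "x \<in> lspan {smat c z | c. True}"
  then obtain F c where F: "finite F" "F \<subseteq> {smat c z | c. True}" "x = (\<Sum>v\<in>F. smat (c v) v)"
    by (auto simp: lspan_def)
  have "\<forall>v\<in>F. \<exists>d. v = smat d z" using F(2) by auto
  then obtain d where d: "\<forall>v\<in>F. v = smat (d v) z" by metis
  have "x = smat (\<Sum>v\<in>F. c v * d v) z"
  proof (intro ext)
    fix i j
    have "x i j = (\<Sum>v\<in>F. c v * v i j)"
      by (simp add: F(3) sum_fun_apply2 smat_def)
    also have "\<dots> = (\<Sum>v\<in>F. c v * d v * z i j)"
    proof (intro sum.cong refl)
      fix v assume "v \<in> F"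
      then have "v i j = d v * z i j" using d by (metis smat_def)
      then show "c v * v i j = c v * d v * z i j" by simp
    qed
    finally show "x i j = smat (\<Sum>v\<in>F. c v * d v) z i j"
      by (simp add: smat_def sum_distrib_right)
  qed
  then show "x \<in> {smat c z | c. True}" by blast
next
  fix x
  assume "x \<in> {smat c z | c. True}"
  then show "x \<in> lspan {smat c z | c. True}"
    by (auto simp: lspan_def smat_def fun_eq_iff intro!: exI[of _ "{x}"] exI[of _ "\<lambda>_. 1"])
qed

text \<open>Both root spaces are lines spanned by opposite matrix units, so all brackets are
  multiples of the coroot E_ss - E_tt, and every multiple occurs.\<close>

lemma coroot_one_dimensional:
  assumes "s < n" "t < n" "s \<noteq> t"
  shows "one_dimensional (lspan {bracket n x y | x y.
           x \<in> root_space n H (wt s t) \<and> y \<in> root_space n H (\<lambda>h. - wt s t h)})"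
proof -
  define z where "z = unhat (\<lambda>k l. of_bool (k = s \<and> l = s) - of_bool (k = t \<and> l = t))"
  have "{bracket n x y | x y. x \<in> root_space n H (wt s t) \<and> y \<in> root_space n H (\<lambda>h. - wt s t h)}
      = {smat (c * d) z | c d. True}"
    unfolding uminus_wt root_space_eq[OF assms] root_space_eq[OF assms(2,1) assms(3)[symmetric]] z_def
    by (auto simp flip: bracket_unit[OF assms(1,2)])
  also have "\<dots> = {smat c z | c. True}"
  proof (intro equalityI subsetI)
    fix x
    assume "x \<in> {smat c z | c. True}"
    then obtain c where "x = smat (c * 1) z" by auto
    then show "x \<in> {smat (c * d) z | c d. True}" by blast
  qed auto
  finally have "lspan {bracket n x y | x y. x \<in> root_space n H (wt s t) \<and> y \<in> root_space n H (\<lambda>h. - wt s t h)}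
      = {smat c z | c. True}"
    by (simp only: lspan_line)
  moreover have "hat z s s = 1" using assms by (simp add: z_def hat_unhat)
  then have "z \<noteq> 0" by (auto simp: coord_zero)
  ultimately show ?thesis by (auto simp: one_dimensional_def)
qed

text \<open>Evaluated at a projection, every root takes a value in \<open>{0, 1, -1}\<close>, and \<open>\<beta>\<close> takes the
  value 1 at a suitable one; so \<open>\<alpha> + k\<beta>\<close> takes the forbidden value 2 for some \<open>k \<le> 3\<close>.\<close>

lemma root_string_bounded:
  assumes "is_root n H \<alpha>" "is_root n H \<beta>" "\<beta> \<noteq> (\<lambda>_. 0)" "0 < n"
  shows "\<exists>k\<ge>1. k \<le> CHAR('a) - 1 \<and> \<not> is_root n H (\<lambda>h. \<alpha> h + of_nat k * \<beta> h)"
proof -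
  obtain r s where rs: "r < n" "s < n" "\<beta> = wt r s"
    using root_is_wt[OF assms(2,4)] .
  then have "r \<noteq> s" using assms(3) by (auto simp: wt_zero)
  have val: "\<gamma> (proj s) \<in> {0, 1, -1}" if root: "is_root n H \<gamma>" for \<gamma>
  proof -
    obtain k l where "k < n" "l < n" "\<gamma> = wt k l"
      using root_is_wt[OF root assms(4)] .
    then show ?thesis using rs(2) by (simp add: wt_proj)
  qed
  have \<beta>: "\<beta> (proj s) = 1" using rs \<open>r \<noteq> s\<close> by (simp add: wt_proj)
  have "(2::'a) \<notin> {0, 1, -1}"
  proof -
    have "(2::'a) - 1 \<noteq> 0" "(2::'a) - (-1) \<noteq> 0"
      using small_nonzero(3) by simp_all
    moreover have "(2::'a) \<noteq> 1" by (metis calculation(1) diff_self)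
    ultimately show ?thesis using small_nonzero(2) by auto
  qed
  then have two: "\<not> is_root n H \<gamma>" if "\<gamma> (proj s) = 2" for \<gamma>
    using val[of \<gamma>] that by auto
  obtain k :: nat where k: "1 \<le> k" "k \<le> 3" "\<alpha> (proj s) + of_nat k = 2"
  proof -
    consider "\<alpha> (proj s) = 0" | "\<alpha> (proj s) = 1" | "\<alpha> (proj s) = -1"
      using val[OF assms(1)] by auto
    then show thesis using that[of 2] that[of 1] that[of 3] by cases auto
  qed
  \<comment> \<open>The bound \<open>k \<le> 3\<close> is within range because the characteristic is
    at least 5.\<close>
  show ?thesis
    using k two[of "\<lambda>h. \<alpha> h + of_nat k * \<beta> h"] \<beta> char by (intro exI[of _ k]) auto
qed

theorem H_classical_cartan: "classical_cartan n H"
proof -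
  have "0 < n" using n_nonzero by (cases n) auto
  show ?thesis
    unfolding classical_cartan_def
  proof (intro conjI allI impI)
    show "cartan n H" by (rule H_cartan)
    show "abelian n H" by (simp add: abelian_def H_abelian)
    show "direct_sum {\<alpha>. lin_fun H \<alpha>} (root_space n H) (sl n)" by (rule H_root_decomposition)
  next
    fix \<alpha>
    assume \<alpha>: "is_root n H \<alpha> \<and> \<alpha> \<noteq> (\<lambda>_. 0)"
    then obtain s t where st: "s < n" "t < n" "\<alpha> = wt s t"
      using root_is_wt \<open>0 < n\<close> by blast
    moreover have "s \<noteq> t" using \<alpha> st by (auto simp: wt_zero)
    ultimately show "one_dimensional (lspan {bracket n x y | x y.
        x \<in> root_space n H \<alpha> \<and> y \<in> root_space n H (\<lambda>h. - \<alpha> h)})"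
      using coroot_one_dimensional by simp
  next
    fix \<alpha> \<beta>
    assume "is_root n H \<alpha> \<and> is_root n H \<beta> \<and> \<beta> \<noteq> (\<lambda>_. 0)"
    then show "\<not> (\<forall>k. 1 \<le> k \<and> k \<le> CHAR('a) - 1 \<longrightarrow> is_root n H (\<lambda>h. \<alpha> h + of_nat k * \<beta> h))"
      using root_string_bounded[of \<alpha> \<beta>] \<open>0 < n\<close> by blast
  qed
qed

end

section \<open>Orthogonal decompositions from mutually unbiased bases\<close>

text \<open>The spectral decomposition of A: the diagonal coordinates are its eigenvalues, and
  \<open>P t x * Q t y\<close> are the entries of the rank one projections.\<close>

lemma (in dual_bases) H_expand:
  assumes "A \<in> H" "x < n" "y < n"
  shows "A x y = (\<Sum>t<n. hat A t t * (P t x * Q t y))"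
proof -
  have "A x y = unhat (hat A) x y"
    using assms(1) by (simp add: unhat_hat H_iff)
  also have "\<dots> = (\<Sum>s<n. \<Sum>t<n. of_bool (s = t) * (hat A s s * (P s x * Q s y)))"
    using assms by (auto simp: uncoord_def H_iff of_bool_def intro!: sum.cong)
  also have "\<dots> = (\<Sum>t<n. hat A t t * (P t x * Q t y))"
    by (intro sum.cong refl) (simp only: sum_of_bool_lessThan, simp)
  finally show ?thesis .
qed

lemma sum_delta_pair:
  fixes A :: "'a::field sqmat"
  assumes "x < n" "y < n"
  shows "(\<Sum>u<n. \<Sum>v<n. A u v * of_bool (x = u \<and> y = v)) = A x y"
proof -
  have "(\<Sum>u<n. \<Sum>v<n. A u v * of_bool (x = u \<and> y = v)) = (\<Sum>u<n. of_bool (x = u) * (\<Sum>v<n. A u v * of_bool (y = v)))"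
    by (simp only: sum_distrib_left of_bool_conj mult_ac)
  also have "\<dots> = A x y"
    using assms by (simp only: sum_of_bool_lessThan if_True)
  finally show ?thesis .
qed

text \<open>With E and F the projections onto vector s of basis a and vector t of basis b, the left
  side of \<open>unbiased\<close> is Tr(EF), which replaces the squared modulus of an inner product.
  \<open>design\<close> is the entrywise form of the tensor identity.\<close>

locale mutually_unbiased =
  fixes n :: nat and P Q :: "nat \<Rightarrow> 'a::field sqmat"
  assumes bases: "a \<le> n \<Longrightarrow> classical_dual_bases n (P a) (Q a)"
    and unbiased: "a \<le> n \<Longrightarrow> b \<le> n \<Longrightarrow> a \<noteq> b \<Longrightarrow> s < n \<Longrightarrow> t < n \<Longrightarrow>
      (\<Sum>x<n. Q a s x * P b t x) * (\<Sum>y<n. Q b t y * P a s y) = 1 / of_nat n"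
    and design: "x < n \<Longrightarrow> y < n \<Longrightarrow> u < n \<Longrightarrow> v < n \<Longrightarrow>
      (\<Sum>a\<le>n. \<Sum>t<n. P a t x * Q a t y * (P a t v * Q a t u))
        = of_bool (x = y \<and> u = v) + of_bool (x = u \<and> y = v)"
begin

abbreviation "D a \<equiv> diag_sub n (P a) (Q a)"

lemma dual: "a \<le> n \<Longrightarrow> dual_bases n (P a) (Q a)"
  using bases by (simp add: classical_dual_bases_def)

text \<open>Expand B in the projections of basis b: by unbiasedness each contributes its eigenvalue
  times 1/n, and the eigenvalues add up to the trace, which is 0. Orthogonality and independence
  both follow from this.\<close>

lemma coord_other:
  assumes "a \<le> n" "b \<le> n" "a \<noteq> b" "B \<in> D b" "s < n"
  shows "coord n (P a) (Q a) B s s = 0"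
proof -
  interpret b: dual_bases n "P b" "Q b" by (rule dual) fact
  let ?c = "\<lambda>t. coord n (P b) (Q b) B t t"
  have "coord n (P a) (Q a) B s s = (\<Sum>x<n. \<Sum>y<n. \<Sum>t<n. ?c t * ((Q a s x * P b t x) * (Q b t y * P a s y)))"
    using b.H_expand[OF assms(4)]
    by (simp add: coord_def[of n "P a"] sum_distrib_left sum_distrib_right mult_ac)
  also have "\<dots> = (\<Sum>x<n. \<Sum>t<n. \<Sum>y<n. ?c t * ((Q a s x * P b t x) * (Q b t y * P a s y)))"
    by (intro sum.cong refl sum.swap)
  also have "\<dots> = (\<Sum>t<n. \<Sum>x<n. \<Sum>y<n. ?c t * ((Q a s x * P b t x) * (Q b t y * P a s y)))"
    by (rule sum.swap)
  also have "\<dots> = (\<Sum>t<n. ?c t * ((\<Sum>x<n. Q a s x * P b t x) * (\<Sum>y<n. Q b t y * P a s y)))"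
    by (simp only: sum_product) (simp only: sum_distrib_left)
  also have "\<dots> = (\<Sum>t<n. ?c t * (1 / of_nat n))"
    using assms by (intro sum.cong refl) (simp add: unbiased)
  also have "\<dots> = mtrace n B / of_nat n"
    by (simp add: b.mtrace_hat sum_divide_distrib)
  also have "\<dots> = 0"
    using assms(4) by (simp add: b.H_iff)
  finally show ?thesis .
qed

text \<open>In the coordinates of basis a, A is diagonal and B has zero diagonal, so every term of
  the trace of AB vanishes.\<close>

lemma orthogonal:
  assumes "a \<le> n" "b \<le> n" "a \<noteq> b" "A \<in> D a" "B \<in> D b"
  shows "killing n A B = 0"
proof -
  interpret a: dual_bases n "P a" "Q a" by (rule dual) fact
  have "mtrace n (mat_mult n A B) = (\<Sum>s<n. \<Sum>k<n. coord n (P a) (Q a) A s k * coord n (P a) (Q a) B k s)"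
    by (simp add: a.mtrace_hat a.hat_mult)
  also have "\<dots> = 0"
  proof (intro sum.neutral ballI)
    fix s k
    assume "s \<in> {..<n}" "k \<in> {..<n}"
    then show "coord n (P a) (Q a) A s k * coord n (P a) (Q a) B k s = 0"
      using assms by (cases "s = k") (auto simp: coord_other a.H_iff)
  qed
  finally show ?thesis by (simp add: killing_def)
qed

lemma sl_eq_sum:
  assumes A: "A \<in> sl n"
  shows "\<exists>F v. finite F \<and> F \<subseteq> {..n} \<and> (\<forall>a\<in>F. v a \<in> D a) \<and> A = sum v F"
proof -
  \<comment> \<open>\<open>v a\<close> is the diagonal part of A in basis a. By
    \<open>design\<close> these parts add up to Tr(A) times the identity, plus A.\<close>
  define v where "v a = uncoord n (P a) (Q a) (\<lambda>s t. of_bool (s = t) * coord n (P a) (Q a) A s s)" for a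
  have "v a \<in> D a" if "a \<le> n" for a
  proof -
    interpret a: dual_bases n "P a" "Q a" by (rule dual) fact
    show ?thesis
      using A by (simp add: v_def a.H_iff a.is_mat_unhat a.mtrace_unhat a.hat_unhat sl_def flip: a.mtrace_hat)
  qed
  moreover have "A = sum v {..n}"
  proof (intro ext)
    fix x y
    show "A x y = sum v {..n} x y"
    proof (cases "x < n \<and> y < n")
      case False
      then show ?thesis
        using A by (auto simp: sum_fun_apply2 v_def uncoord_def sl_def is_mat_def)
    next
      case True
      have "v a x y = (\<Sum>s<n. \<Sum>u<n. \<Sum>w<n. A u w * (P a s x * Q a s y * (P a s w * Q a s u)))" for a
      proof -
        have "v a x y = (\<Sum>s<n. \<Sum>t<n. of_bool (s = t) * (P a s x * coord n (P a) (Q a) A s s * Q a t y))"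
          using True by (simp add: v_def uncoord_def mult_ac)
        also have "\<dots> = (\<Sum>s<n. P a s x * coord n (P a) (Q a) A s s * Q a s y)"
          by (intro sum.cong refl) (simp only: sum_of_bool_lessThan, simp)
        also have "\<dots> = (\<Sum>s<n. \<Sum>u<n. \<Sum>w<n. A u w * (P a s x * Q a s y * (P a s w * Q a s u)))"
          by (simp add: coord_def sum_distrib_left sum_distrib_right mult_ac)
        finally show ?thesis .
      qed
      then have "sum v {..n} x y = (\<Sum>a\<le>n. \<Sum>s<n. \<Sum>(u,w)\<in>{..<n}\<times>{..<n}. A u w * (P a s x * Q a s y * (P a s w * Q a s u)))"
        by (simp add: sum_fun_apply2 sum.cartesian_product)
      also have "\<dots> = (\<Sum>a\<le>n. \<Sum>(u,w)\<in>{..<n}\<times>{..<n}. \<Sum>s<n. A u w * (P a s x * Q a s y * (P a s w * Q a s u)))"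
        unfolding case_prod_unfold by (intro sum.cong refl sum.swap)
      also have "\<dots> = (\<Sum>(u,w)\<in>{..<n}\<times>{..<n}. \<Sum>a\<le>n. \<Sum>s<n. A u w * (P a s x * Q a s y * (P a s w * Q a s u)))"
        unfolding case_prod_unfold by (rule sum.swap)
      also have "\<dots> = (\<Sum>(u,w)\<in>{..<n}\<times>{..<n}. A u w * (of_bool (x = y) * of_bool (u = w)) + A u w * of_bool (x = u \<and> y = w))"
      proof -
        have "(\<Sum>a\<le>n. \<Sum>s<n. A u w * (P a s x * Q a s y * (P a s w * Q a s u)))
            = A u w * (of_bool (x = y) * of_bool (u = w)) + A u w * of_bool (x = u \<and> y = w)"
          if "u < n" "w < n" for u w
          using design[of x y u w] True that
          by (simp flip: sum_distrib_left add: of_bool_conj ring_distribs)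
        then show ?thesis
          unfolding case_prod_unfold by (intro sum.cong refl) auto
      qed
      also have "\<dots> = (\<Sum>u<n. \<Sum>w<n. A u w * (of_bool (x = y) * of_bool (u = w))) + (\<Sum>u<n. \<Sum>w<n. A u w * of_bool (x = u \<and> y = w))"
        by (simp only: sum.cartesian_product [symmetric] sum.distrib)
      also have "(\<Sum>u<n. \<Sum>w<n. A u w * of_bool (x = u \<and> y = w)) = A x y"
        using True by (simp only: sum_delta_pair)
      also have "(\<Sum>u<n. \<Sum>w<n. A u w * (of_bool (x = y) * of_bool (u = w))) = of_bool (x = y) * (\<Sum>u<n. \<Sum>w<n. A u w * of_bool (u = w))"
        by (simp only: sum_distrib_left mult_ac)
      also have "(\<Sum>u<n. \<Sum>w<n. A u w * of_bool (u = w)) = mtrace n A"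
        unfolding mtrace_def by (intro sum.cong refl) (simp only: sum_of_bool_lessThan, simp)
      also have "mtrace n A = 0" using A by (simp add: sl_def)
      finally show ?thesis by simp
    qed
  qed
  ultimately show ?thesis
    by (intro exI[of _ "{..n}"] exI[of _ v]) simp
qed

text \<open>Reading off diagonal coordinates in basis a kills every summand except
  \<open>v a\<close>, whose remaining coordinates vanish by membership in
  \<open>D a\<close>.\<close>

lemma independent:
  assumes F: "finite F" "F \<subseteq> {..n}" and v: "\<And>a. a \<in> F \<Longrightarrow> v a \<in> D a"
    and zero: "sum v F = 0" and a: "a \<in> F"
  shows "v a = 0"
proof -
  have "a \<le> n" using a F by auto
  interpret a: dual_bases n "P a" "Q a" by (rule dual) fact
  show ?thesis
  proof (rule a.hat_eqI)
    show "is_mat n (v a)" using v[OF a] by (simp add: a.H_iff)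
    show "is_mat n (0 :: 'a sqmat)" by (simp add: is_mat_def)
    fix s t
    assume st: "s < n" "t < n"
    have "coord n (P a) (Q a) (v a) s t = 0"
    proof (cases "s = t")
      case True
      have "0 = (\<Sum>b\<in>F. coord n (P a) (Q a) (v b) s s)"
        by (simp only: zero coord_zero flip: coord_sum)
      also have "\<dots> = (\<Sum>b\<in>F. if b = a then coord n (P a) (Q a) (v a) s s else 0)"
        using coord_other[OF \<open>a \<le> n\<close> _ _ v \<open>s < n\<close>] F(2) by (intro sum.cong refl) auto
      also have "\<dots> = coord n (P a) (Q a) (v a) s s"
        using F(1) a by simp
      finally show ?thesis using True by simp
    next
      case False
      then show ?thesis using v[OF a] st by (simp add: a.H_iff)
    qed
    then show "coord n (P a) (Q a) (v a) s t = coord n (P a) (Q a) 0 s t"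
      by (simp add: coord_zero)
  qed
qed

theorem COD: "is_COD n D"
proof -
  have "D a \<subseteq> sl n" for a
    by (auto simp: diag_sub_def)
  then have "direct_sum {..n} D (sl n)"
    by (intro direct_sumI sl_eq_sum independent)
  moreover have "classical_cartan n (D a)" if "a \<le> n" for a
    using classical_dual_bases.H_classical_cartan bases that by blast
  ultimately show ?thesis
    using orthogonal by (simp add: is_COD_def)
qed

end

section \<open>Integer polynomials evaluated at a root of unity\<close>

text \<open>One notion for two uses: \<open>T = UNIV\<close> gives ideals, \<open>T = {}\<close>
  additive subgroups.\<close>

definition closed_under :: "'r set \<Rightarrow> 'r::comm_ring_1 set \<Rightarrow> bool" where
  "closed_under T S \<longleftrightarrow> 0 \<in> S \<and> (\<forall>x\<in>S. \<forall>y\<in>S. x - y \<in> S) \<and> (\<forall>t\<in>T. \<forall>x\<in>S. t * x \<in> S)"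

lemma closed_under_simps:
  assumes "closed_under T S"
  shows "0 \<in> S" "x \<in> S \<Longrightarrow> y \<in> S \<Longrightarrow> x - y \<in> S" "x \<in> S \<Longrightarrow> - x \<in> S"
    "x \<in> S \<Longrightarrow> y \<in> S \<Longrightarrow> x + y \<in> S" "t \<in> T \<Longrightarrow> x \<in> S \<Longrightarrow> t * x \<in> S"
proof -
  show 0: "0 \<in> S" and diff: "x \<in> S \<Longrightarrow> y \<in> S \<Longrightarrow> x - y \<in> S"
    and "t \<in> T \<Longrightarrow> x \<in> S \<Longrightarrow> t * x \<in> S" for x y t
    using assms by (auto simp: closed_under_def)
  show minus: "x \<in> S \<Longrightarrow> - x \<in> S" for x
    using diff[OF 0] by simp
  show "x \<in> S \<Longrightarrow> y \<in> S \<Longrightarrow> x + y \<in> S"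
    using diff[of x "- y"] minus by simp
qed

text \<open>Zorn's lemma. For ideals it yields the residue field, for subgroups a complement of the
  prime field.\<close>

lemma maximal_closed_under:
  assumes "closed_under T S" "1 \<notin> S"
  obtains M where "closed_under T M" "S \<subseteq> M" "1 \<notin> M"
    "\<And>M'. closed_under T M' \<Longrightarrow> M \<subseteq> M' \<Longrightarrow> 1 \<notin> M' \<Longrightarrow> M' = M"
proof -
  define A where "A = {M. closed_under T M \<and> S \<subseteq> M \<and> 1 \<notin> M}"
  have "\<exists>M\<in>A. \<forall>X\<in>A. M \<subseteq> X \<longrightarrow> X = M"
  proof (rule subset_Zorn_nonempty)
    show "A \<noteq> {}" using assms by (auto simp: A_def)
    fix C
    assume C: "C \<noteq> {}" "subset.chain A C"
    then have sub: "C \<subseteq> A" and lin: "\<And>X Y. X \<in> C \<Longrightarrow> Y \<in> C \<Longrightarrow> X \<subseteq> Y \<or> Y \<subseteq> X"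
      by (auto simp: subset_chain_def)
    have cl: "closed_under T X" if "X \<in> C" for X
      using sub that by (auto simp: A_def)
    have "x - y \<in> \<Union>C" if "X \<in> C" "Y \<in> C" "x \<in> X" "y \<in> Y" for x y X Y
      using lin[OF that(1,2)] that closed_under_simps(2)[OF cl] by blast
    moreover have "t * x \<in> \<Union>C" if "t \<in> T" "X \<in> C" "x \<in> X" for t x X
      using closed_under_simps(5)[OF cl] that by blast
    moreover have "0 \<in> \<Union>C"
      using C(1) closed_under_simps(1)[OF cl] by blast
    ultimately have "closed_under T (\<Union>C)"
      unfolding closed_under_def by blast
    then show "\<Union>C \<in> A"
      using sub C(1) by (auto simp: A_def)
  qed
  then show thesis
    using that by (auto simp: A_def)
qed

text \<open>Over the rationals {1} is an independent subset of the complex numbers, so a linear map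
  to the rationals may be prescribed on it.\<close>

lemma additive_functional_complex:
  obtains f :: "complex \<Rightarrow> rat" where "\<And>x y. f (x + y) = f x + f y" "f 1 = 1"
proof -
  interpret C: vector_space "\<lambda>(q::rat) (z::complex). of_rat q * z"
    by unfold_locales (simp_all add: algebra_simps of_rat_add of_rat_mult)
  interpret Q: vector_space "\<lambda>(q::rat) (z::rat). q * z"
    by unfold_locales (simp_all add: algebra_simps)
  interpret vector_space_pair "\<lambda>(q::rat) (z::complex). of_rat q * z" "\<lambda>(q::rat) (z::rat). q * z"
    by unfold_locales
  have "\<not> C.dependent {1}" by simp
  from linear_independent_extend[OF this, of "\<lambda>_. 1"] obtain g
    where g: "Vector_Spaces.linear (\<lambda>(q::rat) (z::complex). of_rat q * z) (\<lambda>(q::rat) (z::rat). q * z) g" "g 1 = 1"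
    by auto
  show thesis
    by (rule that[of g]) (use g module_hom.add[OF module_hom_linearI] in \<open>simp_all add: linear_add\<close>)
qed

locale root_of_unity_eval =
  fixes r :: nat and \<zeta> :: complex
  assumes r: "0 < r" and \<zeta>_def: "\<zeta> = cis (2 * pi / r)"
begin

text \<open>The image is Z[zeta]; computing with integer polynomials and comparing values under
  \<open>ev\<close> avoids a separate type for that ring.\<close>

definition ev :: "int poly \<Rightarrow> complex" where
  "ev g = poly (map_poly of_int g) \<zeta>"

lemma ev_0 [simp]: "ev 0 = 0" and ev_1 [simp]: "ev 1 = 1"
  by (simp_all add: ev_def)

lemma ev_pCons: "ev (pCons c g) = of_int c + \<zeta> * ev g"
  by (simp add: ev_def map_poly_pCons)

lemma ev_add: "ev (g + h) = ev g + ev h"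
  by (induction g h rule: poly_induct2) (simp_all add: ev_pCons algebra_simps)

lemma ev_smult: "ev (smult c g) = of_int c * ev g"
  by (induction g) (simp_all add: ev_pCons algebra_simps)

lemma ev_mult: "ev (g * h) = ev g * ev h"
  by (induction g) (simp_all add: ev_pCons ev_add ev_smult algebra_simps)

lemma ev_minus: "ev (- g) = - ev g"
  using ev_smult[of "-1" g] by simp

lemma ev_diff: "ev (g - h) = ev g - ev h"
  using ev_add[of g "- h"] by (simp add: ev_minus)

lemma ev_power: "ev (g ^ k) = ev g ^ k"
  by (induction k) (simp_all add: ev_mult)

lemma ev_prod: "ev (\<Prod>i\<in>I. f i) = (\<Prod>i\<in>I. ev (f i))"
  by (induction I rule: infinite_finite_induct) (simp_all add: ev_mult)

lemma ev_sum: "ev (\<Sum>i\<in>I. f i) = (\<Sum>i\<in>I. ev (f i))"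
  by (induction I rule: infinite_finite_induct) (simp_all add: ev_add)

lemma ev_of_nat: "ev (of_nat k) = of_nat k"
  by (induction k) (simp_all add: ev_add)

abbreviation X :: "int poly" where "X \<equiv> [:0, 1:]"

lemma ev_X: "ev X = \<zeta>"
  by (simp add: ev_pCons)

lemma zeta_power: "\<zeta> ^ k = cis (2 * pi * k / r)"
  by (simp add: \<zeta>_def DeMoivre mult_ac)

lemma zeta_power_r: "\<zeta> ^ r = 1"
  using r by (simp add: zeta_power)

lemma zeta_power_mod: "\<zeta> ^ k = \<zeta> ^ (k mod r)"
proof -
  have "\<zeta> ^ k = \<zeta> ^ (r * (k div r) + k mod r)" by simp
  also have "\<dots> = \<zeta> ^ (k mod r)"
    unfolding power_add power_mult by (simp add: zeta_power_r)
  finally show ?thesis .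
qed

lemma bij_zeta_power: "bij_betw (\<lambda>k. \<zeta> ^ k) {..<r} {z. z ^ r = 1}"
  using bij_betw_roots_unity[OF r] by (simp add: zeta_power)

lemma prod_zeta: "(\<Prod>k<r. w - \<zeta> ^ k) = w ^ r - 1"
proof -
  let ?U = "{z::complex. z ^ r = 1}"
  let ?q = "\<Prod>z\<in>?U. [:- z, 1:]"
  have fin: "finite ?U" using r by (intro finite_roots_unity) simp
  have card: "card ?U = r" using r by (rule card_roots_unity_eq)
  have deg: "degree ?q = r"
    by (subst degree_prod_eq_sum_degree) (simp_all add: card)
  have "?q = monom 1 r - 1"
  \<comment> \<open>Two monic polynomials of degree r that agree at r points are equal.\<close>
  proof (rule poly_eqI_degree_lead_coeff[where A = ?U and n = r])
    have "lead_coeff ?q = 1"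
      by (simp add: lead_coeff_prod)
    then show "poly.coeff ?q r = poly.coeff (monom 1 r - 1) r"
      using r by (simp add: deg)
    show "degree (monom (1::complex) r - 1) \<le> r"
      by (intro degree_diff_le) (simp_all add: degree_monom_le)
    show "poly ?q z = poly (monom 1 r - 1) z" if "z \<in> ?U" for z
      using that fin by (auto simp: poly_prod poly_monom intro: prod_zero)
  qed (simp_all add: card deg)
  then have "poly ?q w = w ^ r - 1"
    by (simp add: poly_monom)
  moreover have "poly ?q w = (\<Prod>k<r. w - \<zeta> ^ k)"
    unfolding poly_prod by (subst prod.reindex_bij_betw[OF bij_zeta_power, symmetric]) simp
  ultimately show ?thesis by simp
qed

lemma sum_zeta_powers:
  assumes "0 < d" "d < r"
  shows "(\<Sum>j<r. \<zeta> ^ (d * j)) = 0"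
proof -
  have "\<zeta> ^ d \<noteq> \<zeta> ^ 0"
    using inj_onD[OF bij_betw_imp_inj_on[OF bij_zeta_power], of d 0] assms by auto
  then have "(\<Sum>j<r. (\<zeta> ^ d) ^ j) = ((\<zeta> ^ d) ^ r - 1) / (\<zeta> ^ d - 1)"
    by (intro geometric_sum) simp
  also have "(\<zeta> ^ d) ^ r = 1"
    by (simp add: power_mult [symmetric] mult.commute [of d r]) (simp add: power_mult zeta_power_r)
  finally show ?thesis by (simp add: power_mult)
qed

text \<open>An additive map \<open>f : \<complex> \<rightarrow> \<rat>\<close> with \<open>f 1 = 1\<close> has bounded denominators on the finitely generated group
  \<open>\<int>[\<zeta>]\<close>, which therefore cannot contain all powers of \<open>1/p\<close>.\<close>

lemma not_unit:
  assumes "p \<ge> 2"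
  shows "of_nat p * ev h \<noteq> 1"
proof
  assume h: "of_nat p * ev h = 1"
  obtain f :: "complex \<Rightarrow> rat" where add: "\<And>x y. f (x + y) = f x + f y" and one: "f 1 = 1"
    using additive_functional_complex by blast
  have zero: "f 0 = 0" using add[of 0 0] by simp
  have nat: "f (of_nat k * x) = of_nat k * f x" for k x
    by (induction k) (simp_all add: zero add algebra_simps)
  have minus: "f (- x) = - f x" for x
    using add[of x "- x"] zero by (simp add: add_eq_0_iff)
  have int: "f (of_int k * x) = of_int k * f x" for k x
    by (cases k rule: int_cases2) (simp_all add: nat minus)
  \<comment> \<open>A common denominator of f at the r distinct powers of zeta, which generate
    Z[zeta] additively.\<close>
  define D :: int where "D = (\<Prod>i<r. snd (quotient_of (f (\<zeta> ^ i))))"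
  have "D > 0"
    unfolding D_def by (intro prod_pos) (simp add: quotient_of_denom_pos')
  have base: "of_int D * f (\<zeta> ^ k) \<in> \<int>" for k
  proof -
    let ?q = "\<lambda>i. quotient_of (f (\<zeta> ^ i))"
    have "snd (?q (k mod r)) dvd D"
      unfolding D_def using r by (intro dvd_prodI) auto
    then obtain c where c: "D = snd (?q (k mod r)) * c" by (auto simp: dvd_def)
    have "f (\<zeta> ^ k) = of_int (fst (?q (k mod r))) / of_int (snd (?q (k mod r)))"
      using zeta_power_mod[of k] quotient_of_div[of "f (\<zeta> ^ (k mod r))"] by (metis prod.collapse)
    then have "of_int D * f (\<zeta> ^ k) = of_int (c * fst (?q (k mod r)))"
      using quotient_of_denom_pos'[of "f (\<zeta> ^ (k mod r))"] by (simp add: c)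
    then show ?thesis by (simp only: Ints_of_int)
  qed
  \<comment> \<open>The exponent k stays general because each \<open>pCons\<close> moves one factor
    zeta into it.\<close>
  have "of_int D * f (\<zeta> ^ k * ev g) \<in> \<int>" for k g
  proof (induction g arbitrary: k)
    case 0
    then show ?case by (simp add: zero)
  next
    case (pCons c g)
    have "of_int D * f (\<zeta> ^ k * ev (pCons c g)) = of_int c * (of_int D * f (\<zeta> ^ k)) + of_int D * f (\<zeta> ^ Suc k * ev g)"
      using int[of c "\<zeta> ^ k"] by (simp add: ev_pCons algebra_simps add)
    also have "\<dots> \<in> \<int>"
      by (intro Ints_add Ints_mult base Ints_of_int pCons.IH)
    finally show ?case .
  qed
  from this[of 0] have bounded: "of_int D * f (ev g) \<in> \<int>" for g by simp
  \<comment> \<open>The exponent is D itself: h to the power N evaluates to 1/p^N, so p^N would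
    divide D = N, although p^N > N.\<close>
  define N where "N = nat D"
  have N: "N > 0" "of_int D = (of_nat N :: rat)" using \<open>D > 0\<close> by (simp_all add: N_def)
  obtain z where z: "of_int D * f (ev (h ^ N)) = of_int z"
    using bounded[of "h ^ N"] by (auto elim: Ints_cases)
  have "of_nat (p ^ N) * ev (h ^ N) = 1"
    using h by (simp add: ev_power flip: power_mult_distrib)
  then have "of_nat (p ^ N) * f (ev (h ^ N)) = 1"
    using nat[of "p ^ N" "ev (h ^ N)"] one by simp
  then have "of_nat (p ^ N) * of_int z = (of_int D :: rat)"
    unfolding z[symmetric] by (simp add: mult_ac)
  then have "of_int (int (p ^ N) * z) = (of_int D :: rat)" by simp
  then have "int (p ^ N) * z = D" by (simp only: of_int_eq_iff)
  then have "int (p ^ N) dvd D" by (metis dvd_triv_left)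
  then have "int (p ^ N) \<le> D" using \<open>D > 0\<close> by (rule zdvd_imp_le)
  moreover have "N < p ^ N"
    using less_exp[of N] power_mono[of 2 p N] assms by linarith
  ultimately show False using \<open>D > 0\<close> unfolding N_def by linarith
qed

end

section \<open>Finite fields as residue rings\<close>

locale ring_ideal =
  fixes M :: "'r::comm_ring_1 set"
  assumes ideal: "closed_under UNIV M"
begin

lemma zero_mem [simp]: "0 \<in> M"
  and diff_mem: "x \<in> M \<Longrightarrow> y \<in> M \<Longrightarrow> x - y \<in> M"
  and minus_mem: "x \<in> M \<Longrightarrow> - x \<in> M"
  and add_mem: "x \<in> M \<Longrightarrow> y \<in> M \<Longrightarrow> x + y \<in> M"
  and mult_mem: "x \<in> M \<Longrightarrow> t * x \<in> M"
  using closed_under_simps[OF ideal] by simp_all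

lemma mult_mem': "x \<in> M \<Longrightarrow> x * t \<in> M"
  using mult_mem[of x t] by (simp add: mult.commute)

lemma sum_mem: "(\<And>i. i \<in> I \<Longrightarrow> f i \<in> M) \<Longrightarrow> sum f I \<in> M"
  by (induction I rule: infinite_finite_induct) (simp_all add: add_mem)

definition cong :: "'r \<Rightarrow> 'r \<Rightarrow> bool" (infix \<open>\<approx>\<close> 50) where
  "x \<approx> y \<longleftrightarrow> x - y \<in> M"

lemma cong_refl [simp]: "x \<approx> x"
  by (simp add: cong_def)

lemma cong_sym: "x \<approx> y \<Longrightarrow> y \<approx> x"
  using minus_mem[of "x - y"] by (simp add: cong_def)

lemma cong_trans [trans]: "x \<approx> y \<Longrightarrow> y \<approx> z \<Longrightarrow> x \<approx> z"
  using add_mem[of "x - y" "y - z"] by (simp add: cong_def)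

lemma cong_add: "x \<approx> y \<Longrightarrow> x' \<approx> y' \<Longrightarrow> x + x' \<approx> y + y'"
  using add_mem[of "x - y" "x' - y'"] by (simp add: cong_def algebra_simps)

lemma cong_minus: "x \<approx> y \<Longrightarrow> - x \<approx> - y"
  using minus_mem[of "x - y"] by (simp add: cong_def)

lemma cong_diff: "x \<approx> y \<Longrightarrow> x' \<approx> y' \<Longrightarrow> x - x' \<approx> y - y'"
  using cong_add[OF _ cong_minus, of x y x' y'] by simp

lemma cong_mult: "x \<approx> y \<Longrightarrow> x' \<approx> y' \<Longrightarrow> x * x' \<approx> y * y'"
proof -
  assume "x \<approx> y" "x' \<approx> y'"
  then have "x' * (x - y) + y * (x' - y') \<in> M"
    by (intro add_mem mult_mem) (simp_all add: cong_def)
  then show ?thesis by (simp add: cong_def algebra_simps)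
qed

lemma cong_power: "x \<approx> y \<Longrightarrow> x ^ k \<approx> y ^ k"
  by (induction k) (simp_all add: cong_mult)

lemma cong_0_iff: "x \<approx> 0 \<longleftrightarrow> x \<in> M"
  by (simp add: cong_def)

lemma cong_mem: "x \<approx> y \<Longrightarrow> x \<in> M \<longleftrightarrow> y \<in> M"
  using cong_trans cong_sym by (metis cong_0_iff)

lemma cancel_invertible:
  assumes "a * c \<approx> 1" "a * b \<in> M"
  shows "b \<in> M"
proof -
  have "b * (a * c) \<approx> b * 1" by (intro cong_mult assms cong_refl)
  moreover have "b * (a * c) \<in> M" using mult_mem'[OF assms(2), of c] by (simp add: mult_ac)
  ultimately show ?thesis using cong_mem by auto
qed

lemma frobenius:
  assumes p: "prime p" "of_nat p \<in> M"
  shows "(x + y) ^ p \<approx> x ^ p + y ^ p"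
proof -
  let ?f = "\<lambda>k. of_nat (p choose k) * x ^ k * y ^ (p - k)"
  have "p > 0" using p by (simp add: prime_gt_0_nat)
  have "(x + y) ^ p = (\<Sum>k\<le>p. ?f k)" by (rule binomial_ring)
  also have "\<dots> = (\<Sum>k\<in>{0, p}. ?f k) + (\<Sum>k\<in>{..p} - {0, p}. ?f k)"
    by (subst sum.subset_diff[of "{0, p}"]) (auto simp: add.commute)
  also have "(\<Sum>k\<in>{0, p}. ?f k) = x ^ p + y ^ p"
    using \<open>p > 0\<close> by (simp add: add.commute)
  finally have "(x + y) ^ p - (x ^ p + y ^ p) = (\<Sum>k\<in>{..p} - {0, p}. ?f k)" by simp
  also have "\<dots> \<in> M"
  proof (rule sum_mem)
    fix k assume k: "k \<in> {..p} - {0, p}"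
    then have "p dvd (p choose k)"
      using p by (intro dvd_choose_prime) auto
    then obtain c where "p choose k = p * c" by (auto simp: dvd_def)
    then have "?f k = (of_nat c * x ^ k * y ^ (p - k)) * of_nat p" by (simp add: mult_ac)
    then show "?f k \<in> M" using p mult_mem by metis
  qed
  finally show ?thesis by (simp add: cong_def)
qed

lemma frobenius_power:
  assumes p: "prime p" "of_nat p \<in> M"
  shows "(x + y) ^ (p ^ m) \<approx> x ^ (p ^ m) + y ^ (p ^ m)"
proof (induction m)
  case (Suc m)
  have "((x + y) ^ (p ^ m)) ^ p \<approx> (x ^ (p ^ m) + y ^ (p ^ m)) ^ p"
    by (rule cong_power) fact
  also have "\<dots> \<approx> (x ^ (p ^ m)) ^ p + (y ^ (p ^ m)) ^ p"
    by (rule frobenius) fact+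
  finally show ?case by (simp add: mult.commute flip: power_mult)
qed simp

end

text \<open>The field with n elements without a quotient type: equality is congruence modulo
  \<open>M\<close>, and \<open>e\<close> lists one representative of each class, so that sums over
  the field become sums over \<open>i < n\<close>.\<close>

locale residue_field = ring_ideal M for M :: "'r::comm_ring_1 set" +
  fixes n p :: nat and e :: "nat \<Rightarrow> 'r"
  assumes prime_p: "prime p"
    and p_mem: "of_nat p \<in> M"
    and one_not_mem: "1 \<notin> M"
    and inverse_mod: "a \<notin> M \<Longrightarrow> \<exists>b. a * b \<approx> 1"
    and rep: "\<exists>!i. i < n \<and> g \<approx> e i"
begin

lemma mult_mem_iff: "a * b \<in> M \<longleftrightarrow> a \<in> M \<or> b \<in> M"
  using inverse_mod cancel_invertible mult_mem mult_mem' by blast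

end

lemma maximal_ideal_inverse:
  assumes M: "closed_under UNIV M" and max: "\<And>M'. closed_under UNIV M' \<Longrightarrow> M \<subseteq> M' \<Longrightarrow> 1 \<notin> M' \<Longrightarrow> M' = M"
    and a: "a \<notin> M"
  shows "\<exists>b. a * b - 1 \<in> M"
proof -
  interpret ring_ideal M by unfold_locales fact
  \<comment> \<open>The ideal generated by M and a; it is strictly larger than M, so by maximality
    it contains 1.\<close>
  define M' where "M' = {m + a * b | m b. m \<in> M}"
  have "closed_under UNIV M'"
    unfolding closed_under_def
  proof (intro conjI ballI)
    show "0 \<in> M'" by (auto simp: M'_def intro!: exI[of _ 0])
  next
    fix x y assume "x \<in> M'" "y \<in> M'"
    then obtain m b m' b' where "x = m + a * b" "y = m' + a * b'" "m \<in> M" "m' \<in> M"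
      by (auto simp: M'_def)
    then have "x - y = (m - m') + a * (b - b')" "m - m' \<in> M"
      by (simp_all add: algebra_simps diff_mem)
    then show "x - y \<in> M'" unfolding M'_def by blast
  next
    fix t x assume "x \<in> M'"
    then obtain m b where "x = m + a * b" "m \<in> M" by (auto simp: M'_def)
    then have "t * x = t * m + a * (t * b)" "t * m \<in> M"
      by (simp_all add: distrib_left mult.left_commute mult_mem)
    then show "t * x \<in> M'" unfolding M'_def by blast
  qed
  moreover have "M \<subseteq> M'"
  proof
    fix m assume "m \<in> M"
    then have "m = m + a * 0 \<and> m \<in> M" by simp
    then show "m \<in> M'" unfolding M'_def by blast
  qed
  moreover have "a \<in> M'"
  proof -
    have "a = 0 + a * 1 \<and> 0 \<in> M" by simp
    then show ?thesis unfolding M'_def by blast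
  qed
  ultimately have "1 \<in> M'" using max[of M'] a by blast
  then obtain m b where "1 = m + a * b" "m \<in> M" by (auto simp: M'_def)
  then have "a * b - 1 = - m" by (simp add: algebra_simps)
  then show ?thesis using \<open>m \<in> M\<close> minus_mem by metis
qed

text \<open>A maximal ideal over \<open>p\<close> in the ring \<open>\<int>[\<zeta>]\<close> of a primitive \<open>(n-1)\<close>-st root of unity, pulled back to \<open>\<int>[X]\<close>:
  the residue field consists of 0 and the powers of \<open>X\<close>, because it satisfies \<open>g\<^sup>n = g\<close>.\<close>

locale residue_construction = root_of_unity_eval r \<zeta> + ring_ideal M
  for r :: nat and \<zeta> :: complex and M :: "int poly set" +
  fixes p m n :: nat
  assumes prime_p: "prime p" and m: "1 \<le> m" and n: "n = p ^ m" and r_n: "n = Suc r"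
    and lift_mem: "ev g = of_nat p * ev h \<Longrightarrow> g \<in> M"
    and one_not_mem: "1 \<notin> M"
    and inverse: "a \<notin> M \<Longrightarrow> \<exists>b. a * b \<approx> 1"
begin

text \<open>The kernel of \<open>ev\<close> lies in M; through this lemma identities between complex
  numbers become congruences.\<close>

lemma null: "ev g = ev h \<Longrightarrow> g \<approx> h"
  using lift_mem[of "g - h" 0] by (simp add: cong_def ev_diff)

lemma p_mem: "of_nat p \<in> M"
  using lift_mem[of "of_nat p" 1] by (simp add: ev_of_nat)

lemma domain: "a * b \<in> M \<Longrightarrow> a \<notin> M \<Longrightarrow> b \<in> M"
  using inverse cancel_invertible by blast

lemma X_power_r: "X ^ r \<approx> 1"
  by (rule null) (simp add: ev_power ev_X zeta_power_r)

lemma n_mem: "of_nat n \<in> M"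
proof -
  have "of_nat n = of_nat (p ^ (m - 1)) * (of_nat p :: int poly)"
    using m by (simp add: n flip: power_Suc2)
  then show ?thesis using p_mem mult_mem by metis
qed

text \<open>If \<open>X ^ d\<close> were congruent to 1, the sum of \<open>X ^ (d * j)\<close> over
  \<open>j < r\<close> would be congruent to r, yet it evaluates to 0 at zeta. So r would lie in M,
  and with it n - r = 1.\<close>

lemma X_order:
  assumes d: "0 < d" "d < r"
  shows "\<not> X ^ d \<approx> 1"
proof
  assume "X ^ d \<approx> 1"
  then have "X ^ (d * j) - 1 \<in> M" for j
    using cong_power[of "X ^ d" 1 j] by (simp add: power_mult cong_def)
  then have "(\<Sum>j<r. X ^ (d * j) - 1) \<in> M" by (intro sum_mem)
  moreover have "(\<Sum>j<r. X ^ (d * j)) \<approx> 0"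
    by (rule null) (simp add: ev_sum ev_power ev_X sum_zeta_powers[OF d])
  ultimately have "(\<Sum>j<r. X ^ (d * j)) - (\<Sum>j<r. X ^ (d * j) - 1) \<in> M"
    by (intro diff_mem) (simp_all add: cong_0_iff)
  then have "of_nat r \<in> M" by (simp add: sum_subtractf)
  then have "of_nat n - of_nat r \<in> M" using n_mem by (intro diff_mem)
  then show False using one_not_mem r_n by simp
qed

lemma frobenius_n: "(x + y) ^ n \<approx> x ^ n + y ^ n"
  unfolding n by (rule frobenius_power[OF prime_p p_mem])

lemma power_n_const: "(of_int c) ^ n \<approx> of_int c"
proof -
  have nat: "(of_nat k) ^ n \<approx> of_nat k" for k
  proof (induction k)
    case 0
    then show ?case using r_n by simp
  next
    case (Suc k)
    have "(of_nat k + 1) ^ n \<approx> of_nat k ^ n + 1 ^ n" by (rule frobenius_n)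
    also have "\<dots> \<approx> of_nat k + 1" by (intro cong_add Suc) simp
    finally show ?case by (simp add: add.commute)
  qed
  show ?thesis
  proof (cases c rule: int_cases2)
    case (nonneg k)
    then show ?thesis using nat[of k] by simp
  next
    case (nonpos k)
    \<comment> \<open>Expanding a power of 0 settles negative integers without distinguishing the
      parity of n.\<close>
    have "(of_nat k + (- of_nat k)) ^ n \<approx> of_nat k ^ n + (- of_nat k) ^ n" by (rule frobenius_n)
    then have "0 \<approx> of_nat k ^ n + (- of_nat k) ^ n" using r_n by simp
    then have "0 - of_nat k \<approx> of_nat k ^ n + (- of_nat k) ^ n - of_nat k ^ n"
      by (intro cong_diff cong_sym[OF nat])
    then show ?thesis using nonpos cong_sym by simp
  qed
qed

text \<open>The n-th power map is additive and multiplicative modulo M and fixes the integers and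
  \<open>X\<close>, which generate the ring.\<close>

lemma power_n: "g ^ n \<approx> g"
proof (induction g)
  case 0
  then show ?case using r_n by simp
next
  case (pCons c g)
  have eq: "pCons c g = of_int c + X * g" by (simp add: of_int_poly)
  have "X ^ n \<approx> X * 1"
    unfolding r_n power_Suc by (intro cong_mult X_power_r cong_refl)
  then have "(of_int c) ^ n + X ^ n * g ^ n \<approx> of_int c + X * g"
    by (intro cong_add power_n_const cong_mult pCons) simp
  then show ?case
    using cong_trans[OF frobenius_n[of "of_int c" "X * g"]] unfolding eq by (simp only: power_mult_distrib)
qed

text \<open>The exponent is shifted by one because index 0 is taken by the zero class.\<close>

definition rep :: "nat \<Rightarrow> int poly" where
  "rep i = (if i = 0 then 0 else X ^ (i - 1))"

lemma X_power_not_mem: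
  assumes k: "k \<le> r"
  shows "X ^ k \<notin> M"
proof
  assume "X ^ k \<in> M"
  then have "X ^ (r - k) * X ^ k \<in> M" by (rule mult_mem)
  then have "X ^ r \<in> M" using k by (simp flip: power_add)
  then show False using one_not_mem cong_mem[OF X_power_r] by simp
qed

lemma X_power_inj:
  assumes kl: "k < l" "l < r"
  shows "\<not> X ^ k \<approx> X ^ l"
proof
  assume "X ^ k \<approx> X ^ l"
  then have "X ^ k * (X ^ (l - k) - 1) \<in> M"
    using kl cong_sym by (simp add: cong_def right_diff_distrib flip: power_add)
  then have "X ^ (l - k) \<approx> 1"
    using domain X_power_not_mem[of k] kl by (simp add: cong_def)
  then show False using X_order[of "l - k"] kl by simp
qed

text \<open>For g outside M, \<open>power_n\<close> gives \<open>g ^ r - 1 \<in> M\<close>. This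
  factors modulo M into the differences \<open>g - X ^ k\<close>, because it does so after
  evaluation at zeta; as M is prime, one factor lies in M.\<close>

lemma ex_rep: "\<exists>i<n. g \<approx> rep i"
proof (cases "g \<in> M")
  case True
  then show ?thesis using r_n by (intro exI[of _ 0]) (simp add: rep_def cong_0_iff)
next
  case False
  have "g ^ r * g \<approx> g" using power_n[of g] by (simp add: r_n mult.commute)
  then have "g * (g ^ r - 1) \<in> M" by (simp add: cong_def algebra_simps)
  then have "g ^ r - 1 \<in> M" using domain False by blast
  moreover have "(\<Prod>k<r. g - X ^ k) \<approx> g ^ r - 1"
    by (rule null) (simp add: ev_prod ev_diff ev_power ev_X prod_zeta)
  ultimately have "(\<Prod>k<r. g - X ^ k) \<in> M" using cong_mem by blast
  moreover have "\<exists>i\<in>I. f i \<in> M" if "finite I" "prod f I \<in> M" for f :: "nat \<Rightarrow> int poly" and I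
    using that by (induction I rule: finite_induct) (use one_not_mem domain in auto)
  ultimately obtain k where "k < r" "g - X ^ k \<in> M" by blast
  then show ?thesis
    using r_n by (intro exI[of _ "Suc k"]) (simp add: rep_def cong_def)
qed

lemma ex1_rep: "\<exists>!i. i < n \<and> g \<approx> rep i"
proof (rule ex_ex1I)
  show "\<exists>i. i < n \<and> g \<approx> rep i" using ex_rep by blast
  fix i j
  assume "i < n \<and> g \<approx> rep i" "j < n \<and> g \<approx> rep j"
  then have ij: "i < n" "j < n" "rep i \<approx> rep j"
    using cong_trans cong_sym by blast+
  have False if "i < j" "j < n" "rep i \<approx> rep j" for i j
  proof (cases "i = 0")
    case True
    then have "X ^ (j - 1) \<in> M" using that cong_sym[of 0] by (simp add: rep_def cong_0_iff)
    moreover have "j - 1 \<le> r" using that r_n by linarith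
    ultimately show False using X_power_not_mem by blast
  next
    case False
    then have "i - 1 < j - 1" "j - 1 < r" using that r_n by linarith+
    moreover have "X ^ (i - 1) \<approx> X ^ (j - 1)" using that False by (simp add: rep_def)
    ultimately show False using X_power_inj by blast
  qed
  then show "i = j" using ij cong_sym by (metis nat_neq_iff)
qed

lemma residue_field: "residue_field M n p rep"
  by unfold_locales (use prime_p p_mem one_not_mem inverse ex1_rep in auto)

end

theorem residue_field_exists:
  assumes p: "prime (p::nat)" and m: "1 \<le> m" and n: "n = p ^ m"
  shows "\<exists>(M :: int poly set) e. residue_field M n p e"
proof -
  have "p \<ge> 2" using p by (rule prime_ge_2_nat)
  have "p ^ 1 \<le> n" unfolding n using m \<open>p \<ge> 2\<close> by (intro power_increasing) auto
  then have "n \<ge> 2" using \<open>p \<ge> 2\<close> by simp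
  define r where "r = n - 1"
  have r: "0 < r" "n = Suc r" using \<open>n \<ge> 2\<close> by (simp_all add: r_def)
  define \<zeta> where "\<zeta> = cis (2 * pi / r)"
  interpret root_of_unity_eval r \<zeta>
    by unfold_locales (use r in \<open>simp_all add: \<zeta>_def\<close>)
  \<comment> \<open>The preimage of the ideal generated by p in Z[zeta], proper by
    \<open>not_unit\<close>.\<close>
  define J where "J = {g. \<exists>h. ev g = of_nat p * ev h}"
  have "closed_under UNIV J"
    unfolding closed_under_def
  proof (intro conjI ballI)
    show "0 \<in> J" by (auto simp: J_def intro!: exI[of _ 0])
  next
    fix x y assume "x \<in> J" "y \<in> J"
    then obtain h h' where "ev x = of_nat p * ev h" "ev y = of_nat p * ev h'" by (auto simp: J_def)
    then have "ev (x - y) = of_nat p * ev (h - h')" by (simp add: ev_diff algebra_simps)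
    then show "x - y \<in> J" by (auto simp: J_def)
  next
    fix t x assume "x \<in> J"
    then obtain h where "ev x = of_nat p * ev h" by (auto simp: J_def)
    then have "ev (t * x) = of_nat p * ev (t * h)" by (simp add: ev_mult)
    then show "t * x \<in> J" by (auto simp: J_def)
  qed
  moreover have "1 \<notin> J"
    using not_unit[OF \<open>p \<ge> 2\<close>] by (auto simp: J_def)
  ultimately obtain M where M: "closed_under UNIV M" "J \<subseteq> M" "1 \<notin> M"
    and max: "\<And>M'. closed_under UNIV M' \<Longrightarrow> M \<subseteq> M' \<Longrightarrow> 1 \<notin> M' \<Longrightarrow> M' = M"
    by (rule maximal_closed_under) blast
  have "residue_construction r \<zeta> M p m n"
  proof unfold_locales
    show "g \<in> M" if "ev g = of_nat p * ev h" for g h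
      using M(2) that by (auto simp: J_def)
    show "\<exists>b. ring_ideal.cong M (a * b) 1" if "a \<notin> M" for a
      using maximal_ideal_inverse[OF M(1) max that] ring_ideal.cong_def[OF ring_ideal.intro[OF M(1)]] by simp
    show "n = Suc r" by fact
  qed (use p m n r(1) M(1,3) in simp_all)
  then show ?thesis using residue_construction.residue_field by blast
qed

section \<open>Additive characters of the residue field\<close>

context residue_field
begin

lemma rep_inj: "i < n \<Longrightarrow> j < n \<Longrightarrow> e i \<approx> e j \<longleftrightarrow> i = j"
  using rep[of "e i"] cong_refl by blast

lemma rep_exists: "\<exists>i<n. g \<approx> e i"
  using rep[of g] by blast

lemma sum_rep_shift:
  assumes f: "\<And>x y. x \<approx> y \<Longrightarrow> f x = f y"
  shows "(\<Sum>i<n. f (e i + b)) = (\<Sum>i<n. f (e i))"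
proof -
  have "\<forall>i. \<exists>j<n. e i + b \<approx> e j" using rep_exists by blast
  then obtain \<sigma> where \<sigma>: "\<And>i. \<sigma> i < n" "\<And>i. e i + b \<approx> e (\<sigma> i)" by metis
  have "inj_on \<sigma> {..<n}"
  proof (rule inj_onI)
    fix i j
    assume ij: "i \<in> {..<n}" "j \<in> {..<n}" "\<sigma> i = \<sigma> j"
    then have "e i + b \<approx> e j + b"
      using cong_trans[OF \<sigma>(2)[of i]] cong_sym[OF \<sigma>(2)[of j]] by simp
    then have "e i \<approx> e j" by (simp add: cong_def)
    then show "i = j" using ij rep_inj by simp
  qed
  then have "bij_betw \<sigma> {..<n} {..<n}"
    using \<sigma>(1) endo_inj_surj[of "{..<n}" \<sigma>] by (auto simp: bij_betw_def)
  then have "(\<Sum>i<n. f (e (\<sigma> i))) = (\<Sum>i<n. f (e i))"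
    by (rule sum.reindex_bij_betw)
  then show ?thesis using f[OF \<sigma>(2)] by simp
qed

text \<open>Exactly one representative lies in M. It need not be the element 0 itself, hence the
  assumption on all of M.\<close>

lemma sum_rep_delta:
  fixes f :: "'r \<Rightarrow> 'a::comm_semiring_1"
  assumes f: "\<And>x. x \<in> M \<Longrightarrow> f x = c"
  shows "(\<Sum>i<n. f (e i) * of_bool (e i \<in> M)) = c"
proof -
  obtain k where k: "k < n" "0 \<approx> e k" using rep_exists by blast
  then have "e k \<in> M" using cong_sym by (simp add: cong_0_iff flip: cong_0_iff)
  have "(\<Sum>i<n. f (e i) * of_bool (e i \<in> M)) = (\<Sum>i<n. if i = k then c else 0)"
  proof (intro sum.cong refl)
    fix i assume "i \<in> {..<n}"
    then have "e i \<in> M \<longleftrightarrow> i = k"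
      using rep_inj[of i k] k \<open>e k \<in> M\<close> cong_mem[of "e i" "e k"] cong_trans[OF _ k(2), of "e i"] by (auto simp: cong_0_iff)
    then show "f (e i) * of_bool (e i \<in> M) = (if i = k then c else 0)" using f by auto
  qed
  also have "\<dots> = c" using k by simp
  finally show ?thesis .
qed

lemma subgroup_of_nat_mult: "closed_under {} S \<Longrightarrow> x \<in> S \<Longrightarrow> of_nat k * x \<in> S"
  by (induction k) (auto simp: algebra_simps closed_under_simps)

lemma subgroup_of_int_mult:
  assumes "closed_under {} S" "x \<in> S"
  shows "of_int k * x \<in> S"
  using subgroup_of_nat_mult[OF assms] closed_under_simps(3)[OF assms(1)]
  by (cases k rule: int_cases2) auto

lemma bezout_prime:
  assumes "\<not> int p dvd j"
  obtains u v where "of_int u * of_nat p + of_int v * of_int j = (1::'r)"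
proof -
  have "coprime (int p) j"
    using assms prime_p by (intro prime_imp_coprime) auto
  then obtain u v where "u * int p + v * j = 1"
    using bezout_int[of "int p" j] by (auto simp: coprime_iff_gcd_eq_1)
  then have "of_int u * of_nat p + of_int v * of_int j = (1::'r)"
    by (metis of_int_1 of_int_add of_int_mult of_int_of_nat_eq)
  then show thesis by (rule that)
qed

text \<open>S contains M and so all multiples of p; modulo S, an integer prime to p is invertible by
  Bezout.\<close>

lemma subgroup_cancel:
  assumes S: "closed_under {} S" "M \<subseteq> S" and j: "\<not> int p dvd j" "of_int j * x \<in> S"
  shows "x \<in> S"
proof -
  obtain u v where uv: "of_int u * of_nat p + of_int v * of_int j = (1::'r)"
    using bezout_prime[OF j(1)] by blast
  have "x = (of_int u * of_nat p + of_int v * of_int j) * x" by (simp add: uv)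
  also have "\<dots> = (of_int u * x) * of_nat p + of_int v * (of_int j * x)"
    by (simp add: algebra_simps)
  also have "\<dots> \<in> S"
    using S(2) mult_mem[OF p_mem] subgroup_of_int_mult[OF S(1) j(2)]
    by (intro closed_under_simps(4)[OF S(1)]) auto
  finally show ?thesis .
qed

lemma ideal_subgroup: "closed_under {} M"
  using ideal by (simp add: closed_under_def)

text \<open>A maximal additive subgroup avoiding 1 is a complement of the prime field.\<close>

lemma prime_field_complement:
  obtains S where "closed_under {} S" "M \<subseteq> S" "1 \<notin> S" "\<And>x. \<exists>k. x - of_int k \<in> S"
proof -
  obtain S where S: "closed_under {} S" "M \<subseteq> S" "1 \<notin> S"
    and max: "\<And>S'. closed_under {} S' \<Longrightarrow> S \<subseteq> S' \<Longrightarrow> 1 \<notin> S' \<Longrightarrow> S' = S"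
    by (rule maximal_closed_under[OF ideal_subgroup one_not_mem]) blast
  have "\<exists>k. x - of_int k \<in> S" for x
  proof (cases "x \<in> S")
    case True
    then show ?thesis by (intro exI[of _ 0]) simp
  next
    case False
    \<comment> \<open>The subgroup generated by S and x contains 1 by maximality. In 1 = s + jx the
      integer j is prime to p, since otherwise jx, and with it 1, would lie in S.\<close>
    define S' where "S' = {s + of_int j * x | s j. s \<in> S}"
    have "closed_under {} S'"
      unfolding closed_under_def
    proof (intro conjI ballI)
      have "0 = 0 + of_int 0 * x \<and> 0 \<in> S" using closed_under_simps(1)[OF S(1)] by simp
      then show "0 \<in> S'" unfolding S'_def by blast
    next
      fix y y' assume "y \<in> S'" "y' \<in> S'"
      then obtain s j s' j' where "y = s + of_int j * x" "y' = s' + of_int j' * x" "s \<in> S" "s' \<in> S"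
        by (auto simp: S'_def)
      then have "y - y' = (s - s') + of_int (j - j') * x \<and> s - s' \<in> S"
        using closed_under_simps(2)[OF S(1)] by (simp add: algebra_simps)
      then show "y - y' \<in> S'" unfolding S'_def by blast
    qed simp
    moreover have "S \<subseteq> S'"
    proof
      fix s assume "s \<in> S"
      then have "s = s + of_int 0 * x \<and> s \<in> S" by simp
      then show "s \<in> S'" unfolding S'_def by blast
    qed
    moreover have "x \<in> S'"
    proof -
      have "x = 0 + of_int 1 * x \<and> 0 \<in> S" using closed_under_simps(1)[OF S(1)] by simp
      then show ?thesis unfolding S'_def by blast
    qed
    ultimately have "1 \<in> S'" using max[of S'] False by blast
    then obtain s j where sj: "1 = s + of_int j * x" "s \<in> S" by (auto simp: S'_def)
    have "\<not> int p dvd j"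
    proof
      assume "int p dvd j"
      then obtain c where "j = c * int p" by (metis dvdE mult.commute)
      then have "of_int j * x = (of_int c * x) * of_nat p" by simp
      then have "of_int j * x \<in> S" using mult_mem[OF p_mem] S(2) by auto
      then have "s + of_int j * x \<in> S" by (intro closed_under_simps(4)[OF S(1)] sj)
      then show False using sj(1) S(3) by simp
    qed
    then obtain u v where uv: "of_int u * of_nat p + of_int v * of_int j = (1::'r)"
      using bezout_prime by blast
    \<comment> \<open>v inverts j modulo p, so multiplying 1 = s + jx by v identifies x with v
      modulo S.\<close>
    have "x - of_int v = (of_int u * of_nat p + of_int v * of_int j) * x - of_int v * (s + of_int j * x)"
      by (simp only: uv flip: sj(1)) simp
    also have "\<dots> = (of_int u * x) * of_nat p - of_int v * s"
      by (simp add: algebra_simps)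
    also have "\<dots> \<in> S"
      using S(2) mult_mem[OF p_mem] subgroup_of_int_mult[OF S(1) sj(2)]
      by (intro closed_under_simps(2)[OF S(1)]) auto
    finally show ?thesis by blast
  qed
  then show thesis using that S by blast
qed

end

locale residue_character = residue_field M n p e
  for M :: "'r::comm_ring_1 set" and n p e +
  fixes \<chi> :: "'r \<Rightarrow> 'a::field"
  assumes \<chi>_add: "\<chi> (x + y) = \<chi> x * \<chi> y"
    and \<chi>_mem: "x \<in> M \<Longrightarrow> \<chi> x = 1"
    and \<chi>_nontrivial: "\<exists>x. \<chi> x \<noteq> 1"
begin

lemma \<chi>_0 [simp]: "\<chi> 0 = 1"
  by (simp add: \<chi>_mem)

lemma \<chi>_mult_minus: "\<chi> x * \<chi> (- x) = 1"
  using \<chi>_add[of x "- x"] by simp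

lemma \<chi>_nonzero [simp]: "\<chi> x \<noteq> 0"
  using \<chi>_mult_minus[of x] by auto

lemma \<chi>_minus: "\<chi> (- x) = inverse (\<chi> x)"
  using \<chi>_mult_minus[of x] by (metis inverse_unique)

lemma \<chi>_diff: "\<chi> (x - y) = \<chi> x / \<chi> y"
  using \<chi>_add[of x "- y"] by (simp add: \<chi>_minus divide_inverse)

lemma \<chi>_cong: "x \<approx> y \<Longrightarrow> \<chi> x = \<chi> y"
  using \<chi>_mem[of "x - y"] by (simp add: cong_def \<chi>_diff)

text \<open>For a outside M with inverse c, translating the summation variable by
  \<open>c * g\<close> multiplies the sum by \<open>\<chi> g\<close>; a g with
  \<open>\<chi> g \<noteq> 1\<close> makes the sum vanish.\<close>

lemma \<chi>_orthogonality: "(\<Sum>i<n. \<chi> (a * e i)) = of_nat n * of_bool (a \<in> M)"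
proof (cases "a \<in> M")
  case True
  then have "\<chi> (a * e i) = 1" for i by (intro \<chi>_mem mult_mem')
  then show ?thesis using True by simp
next
  case False
  obtain g where g: "\<chi> g \<noteq> 1" using \<chi>_nontrivial by blast
  obtain c where "a * c \<approx> 1" using inverse_mod[OF False] by blast
  then have "a * c * g \<approx> 1 * g" by (rule cong_mult) simp
  then have acg: "\<chi> (a * (c * g)) = \<chi> g" using \<chi>_cong by (simp add: mult.assoc)
  have "(\<Sum>i<n. \<chi> (a * e i)) = (\<Sum>i<n. \<chi> (a * (e i + c * g)))"
    by (rule sum_rep_shift[symmetric]) (intro \<chi>_cong cong_mult cong_refl)
  also have "\<dots> = \<chi> g * (\<Sum>i<n. \<chi> (a * e i))"
    by (simp add: distrib_left \<chi>_add acg sum_distrib_left mult.commute)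
  finally have "(1 - \<chi> g) * (\<Sum>i<n. \<chi> (a * e i)) = 0" by (simp add: algebra_simps)
  then show ?thesis using g False by simp
qed

end

context residue_field
begin

text \<open>Modulo the complement S of the prime field every x is an integer, unique modulo p; the
  character is z raised to that integer.\<close>

lemma character_exists:
  fixes z :: "'a::field"
  assumes z: "z ^ p = 1" "z \<noteq> 1"
  obtains \<chi> :: "'r \<Rightarrow> 'a" where "residue_character M n p e \<chi>"
proof -
  obtain S where S: "closed_under {} S" "M \<subseteq> S" "1 \<notin> S" and ex: "\<And>x. \<exists>k. x - of_int k \<in> S"
    by (rule prime_field_complement) blast
  have "p > 0" using prime_p by (simp add: prime_gt_0_nat)
  then have "z \<noteq> 0" using z by (metis power_0_left not_gr_zero zero_neq_one)
  from ex obtain \<kappa> where \<kappa>: "\<And>x. x - of_int (\<kappa> x) \<in> S" by metis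
  define \<chi> where "\<chi> x = z powi \<kappa> x" for x
  have \<chi>: "\<chi> x = z powi k" if "x - of_int k \<in> S" for x k
  proof -
    have "(x - of_int k) - (x - of_int (\<kappa> x)) \<in> S"
      using that \<kappa> closed_under_simps(2)[OF S(1)] by blast
    then have "of_int (\<kappa> x - k) * 1 \<in> S" by simp
    then have "int p dvd \<kappa> x - k" using subgroup_cancel[OF S(1,2)] S(3) by blast
    then obtain c where c: "\<kappa> x = k + int p * c" by (auto simp: dvd_def algebra_simps)
    have "z powi (int p * c) = 1"
      using z by (simp add: power_int_mult)
    then show ?thesis using \<open>z \<noteq> 0\<close> by (simp add: \<chi>_def c power_int_add)
  qed
  have "residue_character M n p e \<chi>"
  proof unfold_locales
    fix x y
    have "x + y - of_int (\<kappa> x + \<kappa> y) = (x - of_int (\<kappa> x)) + (y - of_int (\<kappa> y))" by simp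
    then have "x + y - of_int (\<kappa> x + \<kappa> y) \<in> S" using \<kappa> closed_under_simps(4)[OF S(1)] by metis
    from \<chi>[OF this] show "\<chi> (x + y) = \<chi> x * \<chi> y"
      using \<open>z \<noteq> 0\<close> by (simp add: \<chi>_def power_int_add)
  next
    fix x assume "x \<in> M"
    then have "x - of_int 0 \<in> S" using S by auto
    from \<chi>[OF this] show "\<chi> x = 1" by simp
  next
    have "1 - of_int 1 \<in> S" using closed_under_simps(1)[OF S(1)] by simp
    from \<chi>[OF this] show "\<exists>x. \<chi> x \<noteq> 1" using z by auto
  qed
  then show thesis using that by blast
qed

end

section \<open>Mutually unbiased bases in prime power dimension\<close>

context residue_character
begin

text \<open>Triviality on \<open>M\<close> makes \<phi> a function of residue classes. The law is
  restricted to a set S so that \<phi> can be built up along growing subgroups when p = 2.\<close>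

definition quadratic :: "'r \<Rightarrow> ('r \<Rightarrow> 'a) \<Rightarrow> 'r set \<Rightarrow> bool" where
  "quadratic a \<phi> S \<longleftrightarrow>
     (\<forall>x\<in>M. \<phi> x = 1) \<and> (\<forall>x\<in>S. \<forall>y\<in>S. \<phi> (x + y) = \<phi> x * \<phi> y * \<chi> (a * x * y))"

lemma quadratic_exists_odd:
  assumes "odd p"
  shows "\<exists>\<phi>. quadratic a \<phi> UNIV"
proof -
  have "even (p + 1)" using assms by simp
  then obtain h where h: "p + 1 = 2 * h" by (rule evenE)
  \<comment> \<open>(p + 1)/2 represents one half modulo p.\<close>
  define c :: 'r where "c = of_nat h"
  have c: "2 * c = of_nat p + 1"
    using arg_cong[OF h, of "of_nat :: nat \<Rightarrow> 'r"] by (simp add: c_def add.commute)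
  have "\<chi> (c * a * (x + y) * (x + y)) = \<chi> (c * a * x * x) * \<chi> (c * a * y * y) * \<chi> (a * x * y)" for x y
  proof -
    have "c * a * (x + y) * (x + y) = c * a * x * x + c * a * y * y + (2 * c) * (a * x * y)"
      by (simp add: algebra_simps)
    also have "\<dots> = c * a * x * x + c * a * y * y + a * x * y + (a * x * y) * of_nat p"
      unfolding c by (simp add: algebra_simps)
    finally show ?thesis
      using mult_mem[OF p_mem, of "a * x * y"] by (simp add: \<chi>_add \<chi>_mem)
  qed
  moreover have "\<chi> (c * a * x * x) = 1" if "x \<in> M" for x
    using that by (intro \<chi>_mem mult_mem)
  ultimately show ?thesis
    unfolding quadratic_def by (intro exI[of _ "\<lambda>x. \<chi> (c * a * x * x)"]) blast
qed

text \<open>In characteristic 2 the function cannot be written down with \<open>\<chi>\<close> alone; it is extended from a subgroup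
  \<open>S\<close> to \<open>S \<union> (S + b)\<close> by choosing \<open>\<phi> b\<close> to be a square root of \<open>\<chi> (a b\<^sup>2) = \<plusminus>1\<close>.\<close>

lemma quadratic_extend:
  assumes p2: "p = 2" and i: "i * i = (-1::'a)"
    and S: "closed_under {} S" "M \<subseteq> S" and \<phi>: "quadratic a \<phi> S" and b: "b \<notin> S"
  shows "\<exists>\<phi>' S'. closed_under {} S' \<and> S \<subseteq> S' \<and> b \<in> S' \<and> quadratic a \<phi>' S'"
proof -
  note S_simps = closed_under_simps(1-4)[OF S(1)]
  have two: "2 * x \<in> M" for x
    using mult_mem[OF p_mem, of x] p2 by (simp add: mult.commute)
  have sq: "\<chi> x * \<chi> x = 1" for x
    using \<chi>_add[of x x] \<chi>_mem[OF two[of x]] by (simp only: mult_2)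
  \<comment> \<open>w is the future value at b. As b + b lies in M, the law demands
    \<open>w * w * \<chi> (a * b * b) = 1\<close>, and character values are their own inverses
    here.\<close>
  obtain w where w: "w * w = \<chi> (a * b * b)"
  proof -
    have "\<chi> (a * b * b) = 1 \<or> \<chi> (a * b * b) = -1"
      using sq[of "a * b * b"] by (simp add: square_eq_1_iff)
    then show thesis using that[of 1] that[of i] i by auto
  qed
  have \<phi>_M: "\<phi> x = 1" if "x \<in> M" for x
    using \<phi> that by (simp add: quadratic_def)
  have \<phi>_add: "\<phi> (x + y) = \<phi> x * \<phi> y * \<chi> (a * x * y)" if "x \<in> S" "y \<in> S" for x y
    using \<phi> that by (simp add: quadratic_def)
  define S' where "S' = S \<union> {x. x - b \<in> S}"
  \<comment> \<open>Off S the value is forced by the law for x = (x - b) + b with value w at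
    b.\<close>
  define \<phi>' where "\<phi>' x = (if x \<in> S then \<phi> x else \<phi> (x - b) * w * \<chi> (a * (x - b) * b))" for x
  have \<phi>'_S: "\<phi>' x = \<phi> x" if "x \<in> S" for x
    using that by (simp add: \<phi>'_def)
  have shift: "s + b \<notin> S" if "s \<in> S" for s
    using S_simps(2)[of "s + b" s] that b by auto
  have \<phi>'_b: "\<phi>' (s + b) = \<phi> s * w * \<chi> (a * s * b)" if "s \<in> S" for s
    using shift[OF that] by (simp add: \<phi>'_def)
  have bb: "b + b \<in> M" using two[of b] by (simp only: mult_2)
  have bbS: "b + b \<in> S" using bb S(2) by blast
  have S'_cases: "x \<in> S \<or> (\<exists>s\<in>S. x = s + b)" if "x \<in> S'" for x
    using that by (auto simp: S'_def intro: bexI[of _ "x - b"])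
  have S'_I: "s \<in> S \<Longrightarrow> s + b \<in> S'" "s \<in> S \<Longrightarrow> s \<in> S'" for s
    by (simp_all add: S'_def)
  have "closed_under {} S'"
    unfolding closed_under_def
  proof (intro conjI ballI)
    show "0 \<in> S'" using S_simps(1) S'_I by blast
    fix x y assume "x \<in> S'" "y \<in> S'"
    then consider "x \<in> S" "y \<in> S" | s where "x = s + b" "s \<in> S" "y \<in> S"
      | t where "x \<in> S" "y = t + b" "t \<in> S" | s t where "x = s + b" "s \<in> S" "y = t + b" "t \<in> S"
      using S'_cases[of x] S'_cases[of y] by blast
    then show "x - y \<in> S'"
    proof cases
      case 1
      then show ?thesis using S'_I(2)[OF S_simps(2)] by simp
    next
      case (2 s)
      then have "x - y = (s - y) + b" "s - y \<in> S" using S_simps by (simp_all add: algebra_simps)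
      then show ?thesis using S'_I by metis
    next
      case (3 t)
      then have "x - y = (x - t - (b + b)) + b" by (simp add: algebra_simps)
      moreover have "x - t - (b + b) \<in> S" using 3 bbS S_simps(2) by blast
      ultimately show ?thesis using S'_I by metis
    next
      case (4 s t)
      then have "x - y = s - t" "s - t \<in> S" using S_simps by simp_all
      then show ?thesis using S'_I by metis
    qed
  qed simp
  moreover have "S \<subseteq> S'" by (auto simp: S'_def)
  moreover have "b \<in> S'" using S_simps(1) by (simp add: S'_def)
  moreover have "quadratic a \<phi>' S'"
    unfolding quadratic_def
  proof (intro conjI ballI)
    show "\<phi>' x = 1" if "x \<in> M" for x
      using that S(2) \<phi>_M by (auto simp: \<phi>'_def)
    have mixed: "\<phi>' (s + b + y) = \<phi>' (s + b) * \<phi>' y * \<chi> (a * (s + b) * y)" if "s \<in> S" "y \<in> S" for s y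
    proof -
      have "\<phi>' (s + b + y) = \<phi>' ((s + y) + b)" by (simp add: algebra_simps)
      also have "\<dots> = \<phi> s * \<phi> y * \<chi> (a * s * y) * w * \<chi> (a * (s + y) * b)"
        using that S_simps by (simp add: \<phi>'_b \<phi>_add)
      also have "\<dots> = \<phi>' (s + b) * \<phi>' y * \<chi> (a * (s + b) * y)"
        using that by (simp add: \<phi>'_b \<phi>'_S distrib_left distrib_right \<chi>_add mult_ac)
      finally show ?thesis .
    qed
    have both: "\<phi>' (s + b + (t + b)) = \<phi>' (s + b) * \<phi>' (t + b) * \<chi> (a * (s + b) * (t + b))" if "s \<in> S" "t \<in> S" for s t
    proof -
      have st: "s + t \<in> S" using that S_simps by blast
      have "\<phi>' (s + b + (t + b)) = \<phi> (s + t + (b + b))"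
        using S_simps(4)[OF st bbS] by (simp add: \<phi>'_S add_ac)
      also have "\<dots> = \<phi> (s + t)"
        using \<phi>_add[OF st bbS] \<phi>_M[OF bb] \<chi>_mem[OF mult_mem[OF bb]] by simp
      also have "\<dots> = \<phi> s * \<phi> t * \<chi> (a * s * t)" using that by (rule \<phi>_add)
      \<comment> \<open>The inserted squares are 1; they supply the cross terms of the expanded
        right-hand side.\<close>
      also have "\<dots> = \<phi> s * \<phi> t * \<chi> (a * s * t) * (\<chi> (a * s * b) * \<chi> (a * s * b)) * (\<chi> (a * t * b) * \<chi> (a * t * b)) * (\<chi> (a * b * b) * \<chi> (a * b * b))"
        by (simp only: sq mult_1_right)
      also have "\<dots> = \<phi> s * \<phi> t * \<chi> (a * s * t) * (\<chi> (a * s * b) * \<chi> (a * s * b)) * (\<chi> (a * t * b) * \<chi> (a * t * b)) * (w * w * \<chi> (a * b * b))"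
        by (simp only: w)
      also have "\<dots> = \<phi>' (s + b) * \<phi>' (t + b) * \<chi> (a * (s + b) * (t + b))"
        using that by (simp add: \<phi>'_b distrib_left distrib_right \<chi>_add mult_ac)
      finally show ?thesis .
    qed
    fix x y assume "x \<in> S'" "y \<in> S'"
    then consider "x \<in> S" "y \<in> S" | s where "x = s + b" "s \<in> S" "y \<in> S"
      | t where "x \<in> S" "y = t + b" "t \<in> S" | s t where "x = s + b" "s \<in> S" "y = t + b" "t \<in> S"
      using S'_cases[of x] S'_cases[of y] by blast
    then show "\<phi>' (x + y) = \<phi>' x * \<phi>' y * \<chi> (a * x * y)"
    proof cases
      case 1
      then show ?thesis using S_simps by (simp add: \<phi>'_S \<phi>_add)
    next
      case 2
      then show ?thesis using mixed by simp
    next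
      case (3 t)
      then have "\<phi>' (y + x) = \<phi>' y * \<phi>' x * \<chi> (a * y * x)" using mixed by simp
      then show ?thesis by (simp add: add.commute mult_ac)
    next
      case 4
      then show ?thesis using both by simp
    qed
  qed
  ultimately show ?thesis by (intro exI[of _ \<phi>'] exI[of _ S'] conjI)
qed

text \<open>Subgroups are measured by the number of representatives they contain, at most n. A
  largest one carrying a quadratic function must be everything, since
  \<open>quadratic_extend\<close> would enlarge it.\<close>

lemma quadratic_exists_two:
  assumes p2: "p = 2" and i: "i * i = (-1::'a)"
  shows "\<exists>\<phi>. quadratic a \<phi> UNIV"
proof -
  define good where "good = (\<lambda>(S, \<phi>). closed_under {} S \<and> M \<subseteq> S \<and> quadratic a \<phi> S)"
  define size where "size = (\<lambda>(S::'r set, \<phi>::'r \<Rightarrow> 'a). card {k. k < n \<and> e k \<in> S})"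
  have "good (M, \<lambda>_. 1)"
    by (auto simp: good_def quadratic_def ideal_subgroup \<chi>_mem mult_mem)
  moreover have "size y < Suc n" for y
  proof -
    have "{k. k < n \<and> e k \<in> fst y} \<subseteq> {..<n}" by auto
    then have "card {k. k < n \<and> e k \<in> fst y} \<le> n" using card_mono[OF finite_lessThan] by fastforce
    then show ?thesis by (simp add: size_def case_prod_unfold)
  qed
  ultimately obtain x where x: "good x" and max: "\<And>y. good y \<Longrightarrow> size y \<le> size x"
    using ex_has_greatest_nat[of good "(M, \<lambda>_. 1)" size "Suc n"] by (auto simp: less_imp_le)
  obtain S \<phi> where [simp]: "x = (S, \<phi>)" by (cases x)
  have S: "closed_under {} S" "M \<subseteq> S" "quadratic a \<phi> S" using x by (simp_all add: good_def)
  have "S = UNIV"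
  proof (rule ccontr)
    assume "S \<noteq> UNIV"
    then obtain b where b: "b \<notin> S" by blast
    from quadratic_extend[OF p2 i S b] obtain \<phi>' S'
      where S': "closed_under {} S'" "S \<subseteq> S'" "b \<in> S'" "quadratic a \<phi>' S'" by blast
    then have "good (S', \<phi>')" using S(2) by (auto simp: good_def)
    from max[OF this] have le: "card {k. k < n \<and> e k \<in> S'} \<le> card {k. k < n \<and> e k \<in> S}"
      by (simp add: size_def)
    obtain k where k: "k < n" "b \<approx> e k" using rep_exists by blast
    then have "b - e k \<in> S" using S(2) by (auto simp: cong_def)
    \<comment> \<open>b is congruent to \<open>e k\<close> modulo M, so this representative enters
      along with b and the count grows strictly.\<close>
    then have "e k \<notin> S" "e k \<in> S'"
      using closed_under_simps(4)[OF S(1), of "b - e k" "e k"] b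
        closed_under_simps(2)[OF S'(1), of b "b - e k"] S' by auto
    then have "{k. k < n \<and> e k \<in> S} \<subset> {k. k < n \<and> e k \<in> S'}" using S'(2) k by blast
    then have "card {k. k < n \<and> e k \<in> S} < card {k. k < n \<and> e k \<in> S'}"
      by (intro psubset_card_mono) auto
    then show False using le by simp
  qed
  then show ?thesis using S by blast
qed

end

section \<open>The bases, their unbiasedness and the design identity\<close>

locale mub_construction = residue_character M n p e \<chi>
  for M :: "'r::comm_ring_1 set" and n p e and \<chi> :: "'r \<Rightarrow> 'a::field" +
  fixes \<phi> :: "nat \<Rightarrow> 'r \<Rightarrow> 'a"
  assumes quadratic: "quadratic (e a) (\<phi> a) UNIV"
    and n_nonzero: "of_nat n \<noteq> (0::'a)"
begin

lemma \<phi>_add: "\<phi> a (x + y) = \<phi> a x * \<phi> a y * \<chi> (e a * x * y)"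
  using quadratic by (simp add: quadratic_def)

lemma \<phi>_mem: "x \<in> M \<Longrightarrow> \<phi> a x = 1"
  using quadratic by (simp add: quadratic_def)

lemma \<phi>_nonzero [simp]: "\<phi> a x \<noteq> 0"
  using \<phi>_add[of a x "- x"] \<phi>_mem[of 0 a] by auto

lemma \<phi>_cong: "x \<approx> y \<Longrightarrow> \<phi> a x = \<phi> a y"
  using \<phi>_add[of a y "x - y"] by (simp add: cong_def \<phi>_mem \<chi>_mem mult_mem)

text \<open>Index n is reserved for the standard basis; a smaller index stands for the field element
  \<open>e a\<close>.\<close>

definition P :: "nat \<Rightarrow> 'a sqmat" where
  "P a t x = (if a = n then of_bool (t = x) else \<phi> a (e x) * \<chi> (e t * e x))"

text \<open>Entrywise inverses replace complex conjugates. The whole factor 1/n sits here, so no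
  square root of n has to exist.\<close>

definition Q :: "nat \<Rightarrow> 'a sqmat" where
  "Q a t x = (if a = n then of_bool (t = x) else inverse (\<phi> a (e x) * \<chi> (e t * e x)) / of_nat n)"

lemma P_standard: "P n t x = of_bool (t = x)" and Q_standard: "Q n t x = of_bool (t = x)"
  by (simp_all add: P_def Q_def)

lemma rep_diff_mem: "i < n \<Longrightarrow> j < n \<Longrightarrow> e i - e j \<in> M \<longleftrightarrow> i = j"
  using rep_inj by (simp add: cong_def)

lemma Q_P_sum:
  assumes "s < n" "t < n"
  shows "(\<Sum>x<n. Q a s x * P a t x) = of_bool (s = t)"
proof (cases "a = n")
  case True
  then show ?thesis using assms by (simp only: P_standard Q_standard sum_of_bool_lessThan) auto
next
  case False
  have "(\<Sum>x<n. Q a s x * P a t x) = (\<Sum>x<n. \<chi> ((e t - e s) * e x)) / of_nat n"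
    unfolding sum_divide_distrib
    by (intro sum.cong refl) (simp add: P_def Q_def False left_diff_distrib \<chi>_diff field_simps)
  also have "\<dots> = of_bool (s = t)"
    using assms n_nonzero by (auto simp: \<chi>_orthogonality rep_diff_mem)
  finally show ?thesis .
qed

lemma P_Q_sum:
  assumes "x < n" "y < n"
  shows "(\<Sum>t<n. P a t x * Q a t y) = of_bool (x = y)"
proof (cases "a = n")
  case True
  then show ?thesis using assms by (simp only: P_standard Q_standard sum_of_bool_lessThan) auto
next
  case False
  have "(\<Sum>t<n. P a t x * Q a t y) = \<phi> a (e x) / \<phi> a (e y) * (\<Sum>t<n. \<chi> ((e x - e y) * e t)) / of_nat n"
    unfolding sum_divide_distrib sum_distrib_left
    by (intro sum.cong refl) (simp add: P_def Q_def False left_diff_distrib \<chi>_diff field_simps)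
  also have "\<dots> = of_bool (x = y)"
    using assms n_nonzero by (auto simp: \<chi>_orthogonality rep_diff_mem)
  finally show ?thesis .
qed

text \<open>The classical evaluation of the modulus of a Gauss sum. Both factors are sums of \<psi>
  and of its reciprocal; after replacing x by x + y, the sum over y of
  \<open>\<chi> ((e b - e a) * e x * e y)\<close> leaves only the zero class of x, because
  \<open>e b - e a\<close> is invertible.\<close>

lemma unbiased_finite:
  assumes ab: "a < n" "b < n" "a \<noteq> b"
  shows "(\<Sum>x<n. Q a s x * P b t x) * (\<Sum>y<n. Q b t y * P a s y) = 1 / of_nat n"
proof -
  obtain k where k: "k = e t - e s" by blast
  define \<psi> where "\<psi> x = \<phi> b x / \<phi> a x * \<chi> (k * x)" for x
  have [simp]: "\<psi> x \<noteq> 0" for x by (simp add: \<psi>_def)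
  have \<psi>_cong: "\<psi> x = \<psi> y" if "x \<approx> y" for x y
    using \<phi>_cong[OF that] \<chi>_cong[OF cong_mult[OF cong_refl that]] by (simp add: \<psi>_def)
  have \<psi>_add: "\<psi> (x + y) / \<psi> y = \<psi> x * \<chi> ((e b - e a) * x * y)" for x y
  proof -
    have "\<chi> ((e b - e a) * x * y) = \<chi> (e b * x * y) / \<chi> (e a * x * y)"
      by (simp add: left_diff_distrib \<chi>_diff)
    then show ?thesis
      unfolding \<psi>_def \<phi>_add distrib_left \<chi>_add by (simp add: field_simps)
  qed
  have "(\<Sum>x<n. Q a s x * P b t x) = (\<Sum>x<n. \<psi> (e x)) / of_nat n"
    unfolding sum_divide_distrib using ab
    by (intro sum.cong refl) (simp add: P_def Q_def \<psi>_def k left_diff_distrib \<chi>_diff field_simps)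
  moreover have "(\<Sum>y<n. Q b t y * P a s y) = (\<Sum>y<n. 1 / \<psi> (e y)) / of_nat n"
    unfolding sum_divide_distrib using ab
    by (intro sum.cong refl) (simp add: P_def Q_def \<psi>_def k left_diff_distrib \<chi>_diff field_simps)
  moreover have "(\<Sum>x<n. \<psi> (e x)) * (\<Sum>y<n. 1 / \<psi> (e y)) = of_nat n"
  proof -
    have "(\<Sum>x<n. \<psi> (e x)) * (\<Sum>y<n. 1 / \<psi> (e y)) = (\<Sum>y<n. (\<Sum>x<n. \<psi> (e x)) * (1 / \<psi> (e y)))"
      by (rule sum_distrib_left)
    also have "\<dots> = (\<Sum>y<n. (\<Sum>x<n. \<psi> (e x + e y)) * (1 / \<psi> (e y)))"
      using sum_rep_shift[of \<psi>, OF \<psi>_cong] by simp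
    also have "\<dots> = (\<Sum>y<n. \<Sum>x<n. \<psi> (e x) * \<chi> ((e b - e a) * e x * e y))"
      by (simp add: sum_divide_distrib \<psi>_add)
    also have "\<dots> = (\<Sum>x<n. \<Sum>y<n. \<psi> (e x) * \<chi> ((e b - e a) * e x * e y))"
      by (rule sum.swap)
    also have "\<dots> = (\<Sum>x<n. of_nat n * \<psi> (e x) * of_bool (e x \<in> M))"
      using ab
      by (intro sum.cong refl) (simp flip: sum_distrib_left add: \<chi>_orthogonality mult_mem_iff rep_diff_mem)
    also have "\<dots> = of_nat n"
    proof (rule sum_rep_delta)
      show "of_nat n * \<psi> x = of_nat n" if "x \<in> M" for x
        using that by (simp add: \<psi>_def \<phi>_mem \<chi>_mem mult_mem)
    qed
    finally show ?thesis .
  qed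
  ultimately show ?thesis using n_nonzero by simp
qed

lemma unbiased_standard:
  assumes "a < n" "s < n" "t < n"
  shows "(\<Sum>x<n. Q a s x * P n t x) * (\<Sum>y<n. Q n t y * P a s y) = 1 / of_nat n"
proof -
  have "(\<Sum>x<n. Q a s x * P n t x) = Q a s t"
    using assms by (simp only: P_standard sum_of_bool_lessThan if_True)
  moreover have "(\<Sum>y<n. Q n t y * P a s y) = P a s t"
    using assms by (simp only: Q_standard sum_of_bool_lessThan if_True)
  moreover have "Q a s t * P a s t = 1 / of_nat n"
    using assms by (simp add: P_def Q_def field_simps)
  ultimately show ?thesis by simp
qed

text \<open>Writing x for \<open>e x\<close> and so on, the sum over t forces x + v = y + u, and
  then the sum over a forces xv = yu. Hence the pairs {x,v} and {y,u} agree.\<close>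

lemma design_finite:
  assumes "x < n" "y < n" "u < n" "v < n"
  shows "(\<Sum>a<n. \<Sum>t<n. P a t x * Q a t y * (P a t v * Q a t u)) = of_bool ((x = y \<and> u = v) \<or> (x = u \<and> y = v))"
proof -
  let ?d = "e x + e v - (e y + e u)" and ?c = "e y * e u - e x * e v"
  have inner: "(\<Sum>t<n. P a t x * Q a t y * (P a t v * Q a t u)) = of_bool (?d \<in> M) * \<chi> (?c * e a) / of_nat n"
    if a: "a < n" for a
  proof -
    have "(\<Sum>t<n. P a t x * Q a t y * (P a t v * Q a t u))
        = (\<phi> a (e x) * \<phi> a (e v)) / (\<phi> a (e y) * \<phi> a (e u)) * (\<Sum>t<n. \<chi> (?d * e t)) / (of_nat n * of_nat n)"
      unfolding sum_divide_distrib sum_distrib_left using a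
      by (intro sum.cong refl) (simp add: P_def Q_def left_diff_distrib distrib_right \<chi>_diff \<chi>_add field_simps)
    also have "\<dots> = of_bool (?d \<in> M) * \<chi> (?c * e a) / of_nat n"
    proof (cases "?d \<in> M")
      case True
      \<comment> \<open>Equal arguments let the law for \<phi> turn the quotient of its values into
        a character value.\<close>
      then have "\<phi> a (e x + e v) = \<phi> a (e y + e u)"
        by (intro \<phi>_cong) (simp add: cong_def)
      then have "(\<phi> a (e x) * \<phi> a (e v)) / (\<phi> a (e y) * \<phi> a (e u)) = \<chi> (e a * e y * e u) / \<chi> (e a * e x * e v)"
        by (simp add: \<phi>_add field_simps)
      also have "\<dots> = \<chi> (?c * e a)"
        unfolding \<chi>_diff [symmetric] by (simp add: algebra_simps)
      finally show ?thesis using True n_nonzero by (simp add: \<chi>_orthogonality)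
    qed (simp add: \<chi>_orthogonality)
    finally show ?thesis .
  qed
  have "?d \<in> M \<and> ?c \<in> M \<longleftrightarrow> (x = y \<and> u = v) \<or> (x = u \<and> y = v)"
  proof
    assume *: "?d \<in> M \<and> ?c \<in> M"
    \<comment> \<open>Vieta: y and u are the roots of a quadratic polynomial that also vanishes at
      x.\<close>
    have "(e x - e y) * (e x - e u) = e x * ?d + ?c" by (simp add: algebra_simps)
    also have "\<dots> \<in> M" using * by (intro add_mem mult_mem) auto
    finally have "x = y \<or> x = u" using assms by (simp add: mult_mem_iff rep_diff_mem)
    moreover have "u = v" if "x = y"
      using * that assms rep_diff_mem[of v u] by auto
    moreover have "y = v" if "x = u"
      using * that assms rep_diff_mem[of v y] by auto
    ultimately show "(x = y \<and> u = v) \<or> (x = u \<and> y = v)" by blast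
  qed (auto simp: mult.commute add.commute)
  moreover have "(\<Sum>a<n. \<Sum>t<n. P a t x * Q a t y * (P a t v * Q a t u))
      = of_bool (?d \<in> M) * (\<Sum>a<n. \<chi> (?c * e a)) / of_nat n"
    unfolding sum_divide_distrib sum_distrib_left by (intro sum.cong refl) (simp add: inner)
  ultimately show ?thesis
    using n_nonzero by (simp add: \<chi>_orthogonality flip: of_bool_conj)
qed

text \<open>The bases with \<open>a < n\<close> count the case x = y = u = v once, the right-hand
  side counts it twice; the standard basis contributes exactly the missing 1.\<close>

lemma design:
  assumes "x < n" "y < n" "u < n" "v < n"
  shows "(\<Sum>a\<le>n. \<Sum>t<n. P a t x * Q a t y * (P a t v * Q a t u))
      = of_bool (x = y \<and> u = v) + of_bool (x = u \<and> y = v)"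
proof -
  have "(\<Sum>t<n. P n t x * Q n t y * (P n t v * Q n t u)) = (\<Sum>t<n. of_bool (t = x) * (of_bool (t = y) * of_bool (t = v) * of_bool (t = u)))"
    by (simp only: P_standard Q_standard mult_ac)
  also have "\<dots> = of_bool (x = y) * of_bool (x = v) * of_bool (x = u)"
    using assms by (simp only: sum_of_bool_lessThan if_True)
  finally show ?thesis
    using design_finite[OF assms] by (simp add: lessThan_Suc_atMost[symmetric]) auto
qed

theorem COD_exists:
  assumes "CHAR('a) \<ge> 5"
  shows "\<exists>H :: nat \<Rightarrow> 'a sqmat set. is_COD n H"
proof -
  have "mutually_unbiased n P Q"
  proof unfold_locales
    fix a b s t
    assume *: "a \<le> n" "b \<le> n" "a \<noteq> b" "s < n" "t < n"
    consider "a < n" "b < n" | "a < n" "b = n" | "a = n" "b < n" using * by linarith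
    then show "(\<Sum>x<n. Q a s x * P b t x) * (\<Sum>y<n. Q b t y * P a s y) = 1 / of_nat n"
      using * unbiased_finite[of a b s t] unbiased_standard[of a s t] unbiased_standard[of b t s]
      by cases (simp_all add: mult.commute)
  qed (use Q_P_sum P_Q_sum n_nonzero assms design in simp_all)
  then show ?thesis using mutually_unbiased.COD by blast
qed

end

theorem theorem2p1:
  fixes p m n :: nat
  assumes "prime p" and "1 \<le> m" and "n = p ^ m"
    and "0 < CHAR('a::field)" and "CHAR('a) \<noteq> 2" and "CHAR('a) \<noteq> 3" and "CHAR('a) \<noteq> p"
    and "(p = 2 \<and> (\<exists>i::'a. i * i = -1)) \<or> (2 < p \<and> (\<exists>z::'a. primitive_root_of_unity p z))"
  shows "\<exists>H :: nat \<Rightarrow> 'a sqmat set. is_COD n H"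
proof -
  have prime_char: "prime CHAR('a)"
    using assms(4) by (rule prime_CHAR_semidom)
  then have "CHAR('a) \<ge> 2" by (rule prime_ge_2_nat)
  \<comment> \<open>With 2 and 3 excluded by assumption, 4 is the last value below 5.\<close>
  moreover have "CHAR('a) \<noteq> 4"
    using prime_char by (auto simp: prime_nat_iff dest!: spec[of _ 2])
  ultimately have char: "CHAR('a) \<ge> 5" using assms(5,6) by linarith
  have n_nonzero: "of_nat n \<noteq> (0::'a)"
  proof
    assume "of_nat n = (0::'a)"
    then have "CHAR('a) dvd p ^ m" by (simp only: of_nat_eq_0_iff_char_dvd assms(3))
    then have "CHAR('a) dvd p" using prime_char prime_dvd_power by blast
    then show False using primes_dvd_imp_eq[OF prime_char assms(1)] assms(7) by simp
  qed
  \<comment> \<open>For p = 2 the nontrivial root is -1; the square root of -1 enters through the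
    functions \<phi>.\<close>
  obtain z :: 'a where z: "z ^ p = 1" "z \<noteq> 1"
  proof (cases "p = 2")
    case True
    have "of_nat 2 \<noteq> (0::'a)"
      using char unfolding of_nat_eq_0_iff_char_dvd by (auto dest: dvd_imp_le)
    then have "(-1::'a) \<noteq> 1" by (metis add.right_inverse of_nat_numeral one_add_one)
    then show thesis using that[of "-1"] True by simp
  next
    case False
    then obtain z :: 'a where "2 < p" "primitive_root_of_unity p z" using assms(8) by blast
    then show thesis using that[of z] spec[of _ 1] by (auto simp: primitive_root_of_unity_def)
  qed
  obtain M :: "int poly set" and e where "residue_field M n p e"
    using residue_field_exists[OF assms(1-3)] by blast
  then interpret residue_field M n p e .
  obtain \<chi> :: "int poly \<Rightarrow> 'a" where "residue_character M n p e \<chi>"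
    using character_exists[OF z] by blast
  then interpret residue_character M n p e \<chi> .
  have "\<exists>\<phi>. quadratic a \<phi> UNIV" for a
  proof (cases "p = 2")
    case True
    then show ?thesis using quadratic_exists_two assms(8) by blast
  next
    case False
    then show ?thesis using quadratic_exists_odd prime_odd_nat[OF assms(1)] assms(8) by blast
  qed
  then have "\<forall>a. \<exists>\<phi>. quadratic (e a) \<phi> UNIV" by blast
  then obtain \<phi> where "\<And>a. quadratic (e a) (\<phi> a) UNIV" by metis
  then interpret mub_construction M n p e \<chi> \<phi>
    by unfold_locales (use n_nonzero in auto)
  show ?thesis using char by (rule COD_exists)
qed

end
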